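(* There exists a non-degenerate continuum of type $(1,0)$ which is not homeomorphic to the circle. That is, there exists a compact connected metric space $X$ with more than one point, not homeomorphic to the circle, which admits a minimal homeomorphism $X\to X$ but admits no minimal non-invertible continuous map $X\to X$.
   Context: A continuum is a nonempty compact connected metric space; it is non-degenerate if it has more than one point. A continuous map $T:X\to X$ is minimal if every forward orbit $\{T^nx:n\ge0\}$ is dense in $X$. A space $X$ is of type $(i,j)$, $i,j\in\{0,1\}$, where $i=1$ if there exists a minimal homeomorphism on $X$ and $i=0$ otherwise, and $j=1$ if there exists a minimal non-invertible continuous self-map of $X$ and $j=0$ otherwise. *)

theory Defs
  imports "HOL-Analysis.Analysis"
begin

definition continuum :: "'a set \<Rightarrow> ('a \<Rightarrow> 'a \<Rightarrow> real) \<Rightarrow> bool" where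
  "continuum M d \<longleftrightarrow> Metric_space M d \<and> M \<noteq> {} \<and>
     compact_space (Metric_space.mtopology M d) \<and>
     connected_space (Metric_space.mtopology M d)"

definition non_degenerate_continuum :: "'a set \<Rightarrow> ('a \<Rightarrow> 'a \<Rightarrow> real) \<Rightarrow> bool" where
  "non_degenerate_continuum M d \<longleftrightarrow> continuum M d \<and> (\<exists>x\<in>M. \<exists>y\<in>M. x \<noteq> y)"

definition minimal_map :: "'a topology \<Rightarrow> ('a \<Rightarrow> 'a) \<Rightarrow> bool" where
  "minimal_map X T \<longleftrightarrow> continuous_map X X T \<and>
     (\<forall>x\<in>topspace X. X closure_of (range (\<lambda>n. (T ^^ n) x)) = topspace X)"

definition admits_minimal_homeomorphism :: "'a topology \<Rightarrow> bool" where
  "admits_minimal_homeomorphism X \<longleftrightarrow>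
     (\<exists>T. minimal_map X T \<and> homeomorphic_map X X T)"

(* An invertible map is one with a continuous inverse.  For compact Hausdorff X this
   is the same as being injective, since a minimal map is then surjective. *)
definition admits_minimal_noninvertible_map :: "'a topology \<Rightarrow> bool" where
  "admits_minimal_noninvertible_map X \<longleftrightarrow>
     (\<exists>T. minimal_map X T \<and> \<not> homeomorphic_map X X T)"

definition space_type :: "'a topology \<Rightarrow> nat \<times> nat" where
  "space_type X = (of_bool (admits_minimal_homeomorphism X),
                   of_bool (admits_minimal_noninvertible_map X))"

(* A fixed type of points for quantifying over metric spaces, the metric being arbitrary.
   This loses no generality: every compact metric space has at most continuum many points,
   so it is isometric to one carried by a subset of this type. *)
type_synonym point = "nat \<Rightarrow> real"

end

theory Submission
  imports Defs
begin

text \<open>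
  Let \<open>Y\<close> be the dyadic solenoid with its linear flow, scaled so that the time-one map is minimal,
  and let \<open>leaf\<close> be the orbit of the unit element. The space is an almost one-to-one extension \<open>X\<close>
  of \<open>Y\<close> in which each \<open>leaf n\<close>, \<open>n\<close> an integer, is blown up to an arc by a \<open>sin (1/x)\<close> singularity;
  the time-one map lifts to a minimal homeomorphism \<open>T\<close> of \<open>X\<close>. Paths in \<open>X\<close> cannot cross the arc over
  an integer, so \<open>X\<close> is not path connected.

  Let \<open>g\<close> be any minimal self-map. It preserves the part of \<open>X\<close> over \<open>leaf\<close>: the part over any other
  leaf is a dense path, whose image can neither cross an integer arc nor lie over a bounded piece of
  \<open>leaf\<close>. So \<open>g\<close> acts there through a coordinate function \<open>u\<close>. The open arcs between integers are
  mapped to sets of diameter at most 1, hence \<open>u (n + 1) \<le> u n + 1\<close>, i.e. the displacement \<open>u n - n\<close>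
  is nonincreasing. It never vanishes, for otherwise a fibre would be invariant, and so it keeps its
  sign and converges at one of the two ends of the leaf. Since the integer points are dense at either
  end, \<open>g\<close> covers a translation of \<open>Y\<close> by the limit, along the flow. Again as
  integers cannot be crossed, the limit is an integer \<open>k\<close>, and \<open>g = T ^ k\<close> is a homeomorphism.
\<close>

section \<open>The dyadic solenoid\<close>

text \<open>Irrationality is what makes the time-one map minimal: it turns coordinate
  \<open>k\<close> by the irrational fraction \<open>theta / 2 ^ k\<close> of a full circle.\<close>

definition theta :: real where "theta = (SOME t. t \<notin> \<rat>)"

lemma theta_irrational: "theta \<notin> \<rat>"
proof -
  have "(UNIV :: real set) \<noteq> \<rat>"
    using countable_rat uncountable_UNIV_real by metis
  then have "\<exists>t::real. t \<notin> \<rat>" by blast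
  then show ?thesis unfolding theta_def by (rule someI_ex)
qed

lemma theta_nonzero [simp]: "theta \<noteq> 0"
  using theta_irrational by auto

definition flow :: "real \<Rightarrow> (nat \<Rightarrow> complex) \<Rightarrow> nat \<Rightarrow> complex" where
  "flow t y = (\<lambda>k. cis (2 * pi * theta * t / 2 ^ k) * y k)"

text \<open>The inverse limit of the circle under squaring.\<close>

definition solenoid :: "(nat \<Rightarrow> complex) set" where
  "solenoid = {y. \<forall>k. norm (y k) = 1 \<and> (y (Suc k))\<^sup>2 = y k}"

definition leaf :: "real \<Rightarrow> nat \<Rightarrow> complex" where
  "leaf t = flow t (\<lambda>k. 1)"

lemma flow_add: "flow s (flow t y) = flow (s + t) y"
  by (simp add: flow_def fun_eq_iff mult.assoc[symmetric] cis_mult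
      distrib_left add_divide_distrib)

lemma flow_0 [simp]: "flow 0 y = y"
  by (simp add: flow_def)

lemma flow_leaf: "flow s (leaf t) = leaf (s + t)"
  by (simp add: leaf_def flow_add)

lemma dist_flow [simp]: "dist (flow t y) (flow t z) = dist y z"
proof -
  have "dist (flow t y k) (flow t z k) = dist (y k) (z k)" for k
    by (simp add: flow_def dist_norm norm_mult flip: right_diff_distrib)
  then show ?thesis by (simp add: dist_fun_def)
qed

lemma flow_inj: "flow t y = flow t z \<longleftrightarrow> y = z"
  by (metis dist_flow dist_eq_0_iff)

lemma flow_eq_leaf_iff: "flow t y = leaf s \<longleftrightarrow> y = leaf (s - t)"
  by (metis flow_inj flow_leaf add.commute diff_add_cancel)

lemma cis_double_half: "(cis (x / 2 ^ Suc k))\<^sup>2 = cis (x / 2 ^ k)"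
  unfolding power2_eq_square cis_mult by (simp add: field_simps)

lemma flow_in_solenoid [simp]: "flow t y \<in> solenoid \<longleftrightarrow> y \<in> solenoid"
proof -
  have "flow s z \<in> solenoid" if "z \<in> solenoid" for s z
    using that cis_double_half
    by (auto simp: solenoid_def flow_def norm_mult power_mult_distrib simp del: power_Suc)
  from this[of y t] this[of "flow t y" "-t"] show ?thesis
    by (auto simp: flow_add)
qed

lemma leaf_in_solenoid [simp]: "leaf t \<in> solenoid"
  unfolding leaf_def by (simp, simp add: solenoid_def)

lemma continuous_on_flow [continuous_intros]:
  fixes f :: "'a::topological_space \<Rightarrow> real" and g :: "'a \<Rightarrow> nat \<Rightarrow> complex"
  assumes "continuous_on S f" "continuous_on S g"
  shows "continuous_on S (\<lambda>x. flow (f x) (g x))"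
  unfolding flow_def
  by (intro continuous_intros assms continuous_on_product_then_coordinatewise[OF assms(2)]) auto

lemma continuous_on_leaf [continuous_intros]:
  fixes f :: "'a::topological_space \<Rightarrow> real"
  assumes "continuous_on S f"
  shows "continuous_on S (\<lambda>x. leaf (f x))"
  unfolding leaf_def by (intro continuous_intros assms)

text \<open>Coordinate \<open>k\<close> turns at a speed that tends to 0 with \<open>k\<close>. For
  large \<open>k\<close> the time difference accounts for less than one full turn there, so
  agreement in that coordinate forces equal times.\<close>

lemma leaf_inj: "leaf s = leaf t \<longleftrightarrow> s = t"
proof
  assume eq: "leaf s = leaf t"
  define d where "d = 2 * pi * theta * (s - t)"
  obtain k :: nat where k: "\<bar>d\<bar> < 2 ^ k"
    using real_arch_pow[of 2 "\<bar>d\<bar>"] by auto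
  have "cis (2 * pi * theta * s / 2 ^ k) = cis (2 * pi * theta * t / 2 ^ k)"
    using fun_cong[OF eq, of k] by (simp add: leaf_def flow_def)
  then have "cis (d / 2 ^ k) = 1"
    by (simp add: d_def right_diff_distrib diff_divide_distrib flip: cis_divide)
  then have "cos (d / 2 ^ k) = 1"
    by (simp add: complex_eq_iff)
  then obtain n :: int where n: "d / 2 ^ k = of_int n * 2 * pi"
    using cos_one_2pi_int by auto
  have "\<bar>d / 2 ^ k\<bar> < 1" using k by (simp add: abs_divide)
  moreover have "\<bar>real_of_int n * 2 * pi\<bar> \<ge> 1" if "n \<noteq> 0"
  proof -
    have "\<bar>real_of_int n\<bar> \<ge> 1" using that by linarith
    then have "1 * 1 \<le> \<bar>real_of_int n\<bar> * (2 * pi)"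
      using pi_ge_two by (intro mult_mono) auto
    then show ?thesis by (simp add: abs_mult)
  qed
  ultimately have "n = 0" using n by force
  with n have "d = 0" by simp
  then show "s = t" by (simp add: d_def)
qed auto

section \<open>Density of the integer orbits of the flow\<close>

lemma tendsto_fun_iff:
  fixes f :: "nat \<Rightarrow> 'a \<Rightarrow> 'b::topological_space"
  shows "f \<longlonglongrightarrow> l \<longleftrightarrow> (\<forall>i. (\<lambda>n. f n i) \<longlonglongrightarrow> l i)"
  using limitin_componentwise[of "\<lambda>_. euclidean" UNIV f l sequentially]
  by (simp add: euclidean_product_topology)

lemma tendsto_flow:
  "f \<longlonglongrightarrow> l \<Longrightarrow> g \<longlonglongrightarrow> m \<Longrightarrow> (\<lambda>n. flow (f n) (g n)) \<longlonglongrightarrow> flow l m" for f :: "nat \<Rightarrow> real"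
  unfolding tendsto_fun_iff flow_def by (intro allI tendsto_intros) auto

lemma solenoid_power:
  assumes "y \<in> solenoid"
  shows "y k = y (k + n) ^ (2 ^ n)"
proof (induction n)
  case (Suc n)
  have "y (k + Suc n) ^ 2 ^ Suc n = ((y (Suc (k + n)))\<^sup>2) ^ 2 ^ n"
    by (simp add: power_mult)
  with Suc assms show ?case by (simp add: solenoid_def)
qed simp

text \<open>The \<open>j\<close>-th coordinate of a point of the solenoid determines all earlier ones, so approximating
  coordinate \<open>j\<close> better and better (by Kronecker's theorem on the circle) suffices.\<close>

lemma flow_orbit_dense:
  assumes y: "y \<in> solenoid" and z: "z \<in> solenoid"
  obtains \<sigma> :: "nat \<Rightarrow> nat" where "\<And>j. j \<le> \<sigma> j" "(\<lambda>j. flow (\<sigma> j) y) \<longlonglongrightarrow> z"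
proof -
  have ex: "\<exists>n\<ge>j. norm (flow (real n) y j - z j) < 1 / 4 ^ j" for j :: nat
  proof -
    have nz: "norm (y j) = 1" "norm (z j) = 1" using y z by (auto simp: solenoid_def)
    then have "norm (z j / y j) = 1" by (simp add: norm_divide)
    then obtain a where a: "z j / y j = cis a"
      using complex_norm_eq_1_exp by (metis cis_conv_exp)
    define \<eta> where "\<eta> = theta / 2 ^ j"
    have "\<eta> \<notin> \<rat>"
    proof
      assume "\<eta> \<in> \<rat>"
      then have "\<eta> * 2 ^ j \<in> \<rat>" by (intro Rats_mult Rats_power) auto
      then show False using theta_irrational by (simp add: \<eta>_def)
    qed
    have "0 < 1 / (4 ^ j * 8 :: real)" by simp
    then obtain h k :: int where "k > 0"
      and k: "\<bar>of_int k * \<eta> - of_int h - (a / (2 * pi) - real j * \<eta>)\<bar> < 1 / (4 ^ j * 8)"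
      using sequence_of_fractional_parts_is_dense[OF \<open>\<eta> \<notin> \<rat>\<close>] by metis
    \<comment> \<open>The Kronecker target was lowered by \<open>j * \<eta>\<close>; adding
      \<open>j\<close> to the multiplier restores it and ensures \<open>n \<ge> j\<close>.\<close>
    define n where "n = nat k + j"
    have n: "real n = of_int k + real j" using \<open>k > 0\<close> by (simp add: n_def)
    define e where "e = 2 * pi * (of_int k * \<eta> - of_int h - (a / (2 * pi) - real j * \<eta>))"
    have e: "e = 2 * pi * (real n * \<eta>) - a - 2 * pi * of_int h"
      by (simp add: e_def n algebra_simps)
    have "cis e = cis (2 * pi * (real n * \<eta>)) / cis a / cis (2 * pi * of_int h)"
      unfolding e by (simp only: cis_divide)
    then have "cis (2 * pi * (real n * \<eta>)) = cis e * (z j / y j)"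
      by (simp add: a cis_multiple_2pi)
    moreover have "flow (real n) y j = cis (2 * pi * (real n * \<eta>)) * y j"
      by (simp add: flow_def \<eta>_def mult_ac)
    moreover have "y j \<noteq> 0" using nz by auto
    ultimately have "flow (real n) y j - z j = (cis e - 1) * z j"
      by (simp add: left_diff_distrib)
    then have "norm (flow (real n) y j - z j) = norm (cis e - 1)"
      using nz by (simp add: norm_mult)
    also have "\<dots> = 2 * \<bar>sin (e / 2)\<bar>"
      by (simp add: cis_conv_exp dist_exp_i_1)
    also have "\<dots> \<le> \<bar>e\<bar>"
      using abs_sin_x_le_abs_x[of "e / 2"] by simp
    also have "\<dots> < 2 * pi * (1 / (4 ^ j * 8))"
      using mult_strict_left_mono[OF k, of "2 * pi"] by (simp add: e_def abs_mult)
    also have "\<dots> \<le> 1 / 4 ^ j"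
      using pi_less_4 by (simp add: field_simps)
    finally show ?thesis by (intro exI[of _ n]) (auto simp: n_def)
  qed
  then obtain \<sigma> where \<sigma>: "\<And>j. j \<le> \<sigma> j" "\<And>j. norm (flow (real (\<sigma> j)) y j - z j) < 1 / 4 ^ j"
    by metis
  \<comment> \<open>Coordinate \<open>i\<close> is the \<open>2 ^ n\<close>-th power of coordinate
    \<open>i + n\<close>, so an error there grows by a factor of at most \<open>2 ^ n\<close>; the
    tolerance \<open>1 / 4 ^ (n + i)\<close> absorbs this.\<close>
  have "(\<lambda>j. flow (\<sigma> j) y i) \<longlonglongrightarrow> z i" for i
  proof (rule LIMSEQ_offset[of _ i], rule LIM_zero_cancel, rule Lim_null_comparison)
    show "\<forall>\<^sub>F n in sequentially. norm (flow (\<sigma> (n + i)) y i - z i) \<le> (1/2)^n"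
    proof (rule always_eventually, rule allI)
      fix n
      let ?w = "flow (\<sigma> (n + i)) y"
      have "?w \<in> solenoid" using y by simp
      then have *: "?w i = ?w (i + n) ^ 2 ^ n" "z i = z (i + n) ^ 2 ^ n" "norm (?w (i + n)) \<le> 1"
          "norm (z (i + n)) \<le> 1"
        using solenoid_power z by (auto simp: solenoid_def)
      have "norm (?w i - z i) \<le> 2 ^ n * norm (?w (i + n) - z (i + n))"
        using norm_power_diff[OF *(3,4), of "2 ^ n"] *(1,2) by simp
      also have "\<dots> \<le> 2 ^ n * (1 / 4 ^ (n + i))"
        using \<sigma>(2)[of "n + i"] by (intro mult_left_mono) (auto simp: add.commute)
      also have "\<dots> \<le> 2 ^ n * (1 / 4 ^ n)"
        by (intro mult_left_mono divide_left_mono power_increasing) auto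
      also have "\<dots> = (1/2) ^ n"
        by (simp add: power_one_over flip: power_mult_distrib power_divide)
      finally show "norm (?w i - z i) \<le> (1/2) ^ n" .
    qed
    show "(\<lambda>n. (1/2::real)^n) \<longlonglongrightarrow> 0" by (intro LIMSEQ_power_zero) auto
  qed
  then have "(\<lambda>j. flow (\<sigma> j) y) \<longlonglongrightarrow> z" by (simp add: tendsto_fun_iff)
  with \<sigma>(1) that show ?thesis by blast
qed

text \<open>Complex conjugation preserves the solenoid and reverses the flow, which reduces this to
  forward time.\<close>

lemma flow_orbit_dense_backward:
  assumes y: "y \<in> solenoid" and z: "z \<in> solenoid"
  obtains \<sigma> :: "nat \<Rightarrow> nat" where "\<And>j. j \<le> \<sigma> j" "(\<lambda>j. flow (- real (\<sigma> j)) y) \<longlonglongrightarrow> z"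
proof -
  have conj: "cnj \<circ> x \<in> solenoid" if "x \<in> solenoid" for x
    using that by (auto simp: solenoid_def simp flip: complex_cnj_power)
  obtain \<sigma> :: "nat \<Rightarrow> nat" where \<sigma>: "\<And>j. j \<le> \<sigma> j"
      "(\<lambda>j. flow (\<sigma> j) (cnj \<circ> y)) \<longlonglongrightarrow> (cnj \<circ> z)"
    using flow_orbit_dense[OF conj[OF y] conj[OF z]] by blast
  have "(\<lambda>j. cnj (flow (\<sigma> j) (cnj \<circ> y) k)) \<longlonglongrightarrow> cnj (cnj (z k))" for k
    using \<sigma>(2) by (intro tendsto_cnj) (simp add: tendsto_fun_iff)
  then have "(\<lambda>j. flow (- real (\<sigma> j)) y) \<longlonglongrightarrow> z"
    by (simp add: tendsto_fun_iff flow_def cis_cnj)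
  with \<sigma>(1) that show ?thesis by blast
qed

section \<open>Lifting to the leaf and the oscillating function\<close>

text \<open>On a Borsukian set coordinate 0 has a continuous logarithm, which determines
  \<open>u\<close>. Each further coordinate is a square root of the one before, so it is correct up
  to a sign; the sign is constant by connectedness and is 1 at \<open>e\<close>.\<close>

lemma solenoid_lift:
  fixes S :: "'a::real_normed_vector set"
  assumes S: "Borsukian S" "connected S"
    and q: "continuous_on S q" "q ` S \<subseteq> solenoid" and e: "e \<in> S"
  obtains u where "continuous_on S u" "u e = 0" "\<And>x. x \<in> S \<Longrightarrow> q x = flow (u x) (q e)"
proof -
  have nq: "norm (q x k) = 1" "(q x (Suc k))\<^sup>2 = q x k" if "x \<in> S" for x k
    using q(2) that by (auto simp: solenoid_def)
  have contq: "continuous_on S (\<lambda>x. q x k)" for k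
    using continuous_on_product_then_coordinatewise[OF q(1)] .
  have "(\<lambda>x. q x 0) \<in> S \<rightarrow> sphere 0 1"
    using nq by auto
  then obtain g where g: "continuous_on S (complex_of_real \<circ> g)"
      "\<And>x. x \<in> S \<Longrightarrow> q x 0 = exp (\<i> * of_real (g x))"
    using S(1) contq unfolding Borsukian_continuous_logarithm_circle_real by blast
  have contg: "continuous_on S g"
    using continuous_on_Re[OF g(1)] by (simp add: o_def)
  define u where "u x = (g x - g e) / (2 * pi * theta)" for x
  have contu: "continuous_on S u"
    unfolding u_def by (intro continuous_intros contg) auto
  define h where "h k x = q x k / flow (u x) (q e) k" for k x
  have n1: "norm (flow (u x) (q e) k) = 1" for x k
    using nq[OF e] by (simp add: flow_def norm_mult)
  then have nz: "flow (u x) (q e) k \<noteq> 0" for x k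
    by (metis norm_zero zero_neq_one)
  have "flow (u x) (q e) \<in> solenoid" for x
    using q(2) e by auto
  then have sq: "(flow (u x) (q e) (Suc k))\<^sup>2 = flow (u x) (q e) k" for x k
    by (simp add: solenoid_def)
  have h1: "\<forall>x\<in>S. h k x = 1" for k
  proof (induction k)
    case 0
    have "2 * pi * theta * u x = g x - g e" for x
      by (simp add: u_def)
    then show ?case
      using g(2) e by (simp add: h_def flow_def cis_conv_exp flip: exp_add)
        (simp add: algebra_simps)
  next
    case (Suc k)
    have "(h (Suc k) x)\<^sup>2 = 1" if "x \<in> S" for x
      using Suc that nq(2)[OF that] sq by (simp add: h_def power_divide)
    then have "h (Suc k) ` S \<subseteq> {1, -1}"
      by (auto simp: power2_eq_1_iff)
    then have "finite (h (Suc k) ` S)"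
      by (rule finite_subset) auto
    moreover have "continuous_on S (h (Suc k))"
      unfolding h_def
      by (intro continuous_on_divide contq continuous_on_product_then_coordinatewise[OF
            continuous_on_flow[OF contu continuous_on_const]]) (use nz in auto)
    ultimately obtain a where "\<And>x. x \<in> S \<Longrightarrow> h (Suc k) x = a"
      using continuous_finite_range_constant[OF S(2)] unfolding constant_on_def by metis
    moreover have "h (Suc k) e = 1"
      using nz[of e] by (simp add: h_def u_def)
    ultimately show ?case using e by metis
  qed
  show ?thesis
  proof
    show "u e = 0" by (simp add: u_def)
    show "q x = flow (u x) (q e)" if "x \<in> S" for x
      using h1 that nz by (auto simp: h_def fun_eq_iff)
  qed (rule contu)
qed

lemma solenoid_lift_leaf:
  fixes S :: "'a::real_normed_vector set"
  assumes S: "Borsukian S" "connected S"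
    and q: "continuous_on S q" "q ` S \<subseteq> solenoid" and e: "e \<in> S" "q e \<in> range leaf"
  obtains u where "continuous_on S u" "\<And>x. x \<in> S \<Longrightarrow> q x = leaf (u x)"
proof -
  obtain u where u: "continuous_on S u" "\<And>x. x \<in> S \<Longrightarrow> q x = flow (u x) (q e)"
    using solenoid_lift[OF S q e(1)] by metis
  obtain a where "q e = leaf a" using e(2) by blast
  then have "q x = leaf (u x + a)" if "x \<in> S" for x
    using u(2)[OF that] by (simp add: flow_leaf)
  moreover have "continuous_on S (\<lambda>x. u x + a)"
    by (intro continuous_intros u(1))
  ultimately show ?thesis using that by blast
qed

text \<open>A \<open>sin (1/x)\<close> profile along the leaf. Distance in the solenoid replaces
  \<bar>c\<bar>, so that the profile is the restriction of a function continuous on the solenoid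
  minus one point. Since \<open>1 / 0 = 0\<close>, its value at 0 is 0.\<close>

definition osc :: "real \<Rightarrow> real" where
  "osc c = sin (1 / dist (leaf c) (leaf 0))"

lemma sin_dist_leaf: "sin (1 / dist (leaf a) (leaf b)) = osc (a - b)"
  using dist_flow[of "-b" "leaf a" "leaf b"] by (simp add: osc_def flow_leaf)

lemma osc_minus [simp]: "osc (- c) = osc c"
  using sin_dist_leaf[of 0 c] by (simp add: osc_def dist_commute)

lemma continuous_on_osc: "continuous_on (- {0}) osc"
  unfolding osc_def by (intro continuous_intros) (auto simp: leaf_inj)

lemma abs_osc_le [simp]: "\<bar>osc c\<bar> \<le> 1"
  by (simp add: osc_def)

text \<open>The distance to \<open>leaf 0\<close> is continuous and vanishes at 0, so by the
  intermediate value theorem it takes the value \<open>1 / a\<close> for every large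
  \<open>a\<close>, in particular for one with sine \<open>v\<close>.\<close>

lemma osc_attains:
  assumes v: "\<bar>v\<bar> \<le> 1" and \<delta>: "\<delta> > 0"
  obtains c where "0 < c" "c < \<delta>" "osc c = v"
proof -
  let ?D = "\<lambda>c. dist (leaf c) (leaf 0)"
  have pos: "?D (\<delta> / 2) > 0" using \<delta> by (simp add: leaf_inj)
  \<comment> \<open>The extra 2 compensates for \<open>arcsin v\<close>, which may be negative but
    is at least -2.\<close>
  obtain k :: nat where k: "1 / ?D (\<delta> / 2) + 2 < real k"
    using reals_Archimedean2 by blast
  define a where "a = arcsin v + 2 * real k * pi"
  have "real k * 1 \<le> real k * (2 * pi)"
    using pi_ge_two by (intro mult_left_mono) auto
  moreover have "- 2 \<le> arcsin v"
    using arcsin_lbound[of v] v pi_less_4 by (auto simp: abs_le_iff)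
  ultimately have a: "1 / ?D (\<delta> / 2) < a"
    using k by (simp add: a_def mult_ac)
  then have a0: "a > 0" using pos by (smt (verit) zero_less_divide_1_iff)
  have "1 / a \<le> ?D (\<delta> / 2)"
    using a a0 pos by (simp add: field_simps)
  moreover have "continuous_on {0..\<delta> / 2} ?D" by (intro continuous_intros)
  ultimately obtain c where c: "0 \<le> c" "c \<le> \<delta> / 2" "?D c = 1 / a"
    using IVT'[of ?D 0 "1 / a" "\<delta> / 2"] a0 \<delta> by auto
  have "osc c = sin a" using c(3) by (simp add: osc_def)
  also have "\<dots> = v"
    using v by (simp add: a_def sin_add abs_le_iff)
  finally have "osc c = v" .
  moreover have "c \<noteq> 0" using c(3) a0 by auto
  then have "0 < c" "c < \<delta>" using c \<delta> by auto
  ultimately show ?thesis using that by blast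
qed

text \<open>After the last time before \<open>t2\<close> at which \<open>v \<le> 0\<close>, \<open>v\<close> runs through a whole
  right neighbourhood of \<open>0\<close>, on which \<open>osc\<close> takes the values \<open>1\<close> and \<open>-1\<close>.\<close>

lemma no_crossing_right:
  fixes S :: "real set"
  assumes S: "connected S" and v: "continuous_on S v" and s: "continuous_on S s"
    and vs: "\<And>t. t \<in> S \<Longrightarrow> v t \<noteq> 0 \<Longrightarrow> s t = osc (v t)"
    and t: "t1 \<in> S" "t2 \<in> S" "t1 < t2" "v t1 \<le> 0"
  shows "v t2 \<le> 0"
proof (rule ccontr)
  assume "\<not> v t2 \<le> 0"
  have sub: "{t1..t2} \<subseteq> S"
    using S t connected_contains_Icc by blast
  define K where "K = {t1..t2} \<inter> v -` {..0}"
  have contv: "continuous_on {t1..t2} v" using v sub continuous_on_subset by blast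
  then have "closed K"
    unfolding K_def by (intro continuous_closed_preimage) auto
  moreover have K: "t1 \<in> K" "bdd_above K" using t by (auto simp: K_def)
  ultimately have "Sup K \<in> K" using closed_contains_Sup by blast
  define r where "r = Sup K"
  have r: "t1 \<le> r" "r < t2" "v r \<le> 0"
    using \<open>Sup K \<in> K\<close> \<open>\<not> v t2 \<le> 0\<close> by (auto simp: K_def r_def less_le)
  have after: "v t > 0" if "r < t" "t \<le> t2" for t
    using cSup_upper[OF _ K(2), of t] that r by (force simp: K_def r_def)
  have "r \<in> S" using r sub by auto
  then obtain \<delta> where \<delta>: "\<delta> > 0" "\<And>x. x \<in> S \<Longrightarrow> dist x r < \<delta> \<Longrightarrow> dist (s x) (s r) < 1"
    using s unfolding continuous_on_iff by (metis zero_less_one)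
  define t3 where "t3 = min t2 (r + \<delta> / 2)"
  have t3: "r < t3" "t3 \<le> t2" "t3 - r < \<delta>" using r \<delta>(1) by (auto simp: t3_def)
  have near: "dist w (s r) < 1" if w: "\<bar>w\<bar> \<le> 1" for w
  proof -
    obtain c where c: "0 < c" "c < v t3" "osc c = w"
      using osc_attains[OF w after[OF t3(1,2)]] by blast
    have "continuous_on {r..t3} v"
      using contv r t3 by (auto intro: continuous_on_subset)
    then obtain x where x: "r \<le> x" "x \<le> t3" "v x = c"
      using IVT'[of v r c t3] c r t3 by auto
    then have "x \<in> S" using r t3 sub by auto
    then have "s x = w" using vs[of x] x c by auto
    moreover have "dist x r < \<delta>" using x t3 by (simp add: dist_real_def)
    ultimately show ?thesis using \<delta>(2)[OF \<open>x \<in> S\<close>] by simp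
  qed
  \<comment> \<open>No number is closer than 1 to both 1 and -1.\<close>
  show False using near[of 1] near[of "-1"] by (simp add: dist_real_def)
qed

lemma no_crossing:
  fixes S :: "real set"
  assumes S: "connected S" and v: "continuous_on S v" and s: "continuous_on S s"
    and vs: "\<And>t. t \<in> S \<Longrightarrow> v t \<noteq> 0 \<Longrightarrow> s t = osc (v t)"
    and t: "t1 \<in> S" "t2 \<in> S" "v t1 \<le> 0"
  shows "v t2 \<le> 0"
proof (cases t1 t2 rule: linorder_cases)
  case less
  then show ?thesis using no_crossing_right[OF S v s vs t(1,2) _ t(3)] by blast
next
  case greater
  \<comment> \<open>Time reversal exchanges the two orders of \<open>t1\<close> and
    \<open>t2\<close>.\<close>
  have "v (- (- t2)) \<le> 0"
  proof (rule no_crossing_right[where S = "uminus ` S" and v = "\<lambda>t. v (- t)" and s = "\<lambda>t. s (- t)"])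
    show "connected (uminus ` S)"
      by (intro connected_continuous_image continuous_intros S)
    show "continuous_on (uminus ` S) (\<lambda>t. v (- t))" "continuous_on (uminus ` S) (\<lambda>t. s (- t))"
      by (rule continuous_on_compose2[OF v] continuous_on_compose2[OF s];
          auto intro: continuous_intros)+
  qed (use vs t greater in auto)
  then show ?thesis by simp
qed (use t in simp)

text \<open>A two-sided topologist's sine curve with its limit bar at real part 0. It models the
  part of the space over a leaf segment of length 1 centred at an integer.\<close>

definition window :: "complex set" where
  "window = {z. \<bar>Re z\<bar> \<le> 1/2 \<and> \<bar>Im z\<bar> \<le> 1 \<and> (Re z \<noteq> 0 \<longrightarrow> Im z = osc (Re z))}"

lemma closed_window: "closed window"
  unfolding closed_sequential_limits
proof clarify
  fix x l assume x: "\<forall>n. x n \<in> window" and lim: "x \<longlonglongrightarrow> l"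
  have Re: "(\<lambda>n. Re (x n)) \<longlonglongrightarrow> Re l" and Im: "(\<lambda>n. Im (x n)) \<longlonglongrightarrow> Im l"
    using lim by (auto intro: tendsto_intros)
  have "\<bar>Re l\<bar> \<le> 1/2" "\<bar>Im l\<bar> \<le> 1"
    by (rule tendsto_upperbound[OF tendsto_rabs[OF Re]] tendsto_upperbound[OF tendsto_rabs[OF Im]];
        use x in \<open>auto simp: window_def\<close>)+
  moreover have "Im l = osc (Re l)" if "Re l \<noteq> 0"
  proof -
    have "isCont osc (Re l)"
      using continuous_on_osc that
      by (simp add: continuous_on_eq_continuous_at open_Compl)
    then have "(\<lambda>n. osc (Re (x n))) \<longlonglongrightarrow> osc (Re l)"
      using Re by (rule isCont_tendsto_compose)
    moreover have "\<forall>\<^sub>F n in sequentially. osc (Re (x n)) = Im (x n)"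
      using tendsto_imp_eventually_ne[OF Re that] x by (auto simp: window_def elim: eventually_mono)
    ultimately have "(\<lambda>n. Im (x n)) \<longlonglongrightarrow> osc (Re l)"
      by (rule Lim_transform_eventually)
    then show ?thesis using Im LIMSEQ_unique by blast
  qed
  ultimately show "l \<in> window" by (simp add: window_def)
qed

lemma compact_window: "compact window"
proof -
  have "norm z \<le> 2" if "z \<in> window" for z
    using that cmod_le[of z] by (auto simp: window_def)
  then show ?thesis
    using closed_window by (auto simp: compact_eq_bounded_closed bounded_iff)
qed

lemma graph_in_window: "0 < \<bar>c\<bar> \<Longrightarrow> \<bar>c\<bar> \<le> 1/2 \<Longrightarrow> Complex c (osc c) \<in> window"
  by (simp add: window_def)

lemma bar_in_window: "\<bar>r\<bar> \<le> 1 \<Longrightarrow> Complex 0 r \<in> window"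
  by (simp add: window_def)

lemma zero_in_window: "0 \<in> window"
  by (simp add: window_def)

lemma osc_sequence:
  assumes "\<bar>v\<bar> \<le> 1"
  obtains c where "\<And>i. 0 < c i" "\<And>i. c i < 1/2" "\<And>i. osc (c i) = v" "c \<longlonglongrightarrow> 0"
proof -
  have "\<exists>c. 0 < c \<and> c < 1 / real (i + 2) \<and> osc c = v" for i
    using osc_attains[OF assms, of "1 / real (i + 2)"] by (metis of_nat_0_less_iff add_pos_nonneg zero_less_divide_1_iff zero_less_numeral add.commute zero_le)
  then obtain c where c: "\<And>i. 0 < c i" "\<And>i. c i < 1 / real (i + 2)" "\<And>i. osc (c i) = v"
    by metis
  have "c i < 1/2" for i
    by (rule less_le_trans[OF c(2)]) (simp add: field_simps)
  moreover have "c \<longlonglongrightarrow> 0"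
  proof (rule tendsto_sandwich[of "\<lambda>_. 0" _ _ "\<lambda>i. 1 / real (i + 2)"])
    show "(\<lambda>i. 1 / real (i + 2)) \<longlonglongrightarrow> 0" by real_asymp
  qed (use c in \<open>auto intro!: always_eventually less_imp_le\<close>)
  ultimately show ?thesis using that c by blast
qed

text \<open>Each half is a graph over an interval together with the bar in its closure, hence
  connected; the two halves share the bar.\<close>

lemma connected_window: "connected window"
proof -
  define G where "G \<sigma> = (\<lambda>c. Complex (\<sigma> * c) (osc c)) ` {0<..1/2}" for \<sigma> :: real
  define B where "B = Complex 0 ` {-1..1}"
  have "connected (G \<sigma> \<union> B)" if "\<bar>\<sigma>\<bar> = 1" for \<sigma>
  proof (rule connected_intermediate_closure)
    show "connected (G \<sigma>)"
      unfolding G_def Complex_eq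
      by (intro connected_continuous_image continuous_intros
          continuous_on_subset[OF continuous_on_osc]) auto
    have "Complex 0 r \<in> closure (G \<sigma>)" if r: "\<bar>r\<bar> \<le> 1" for r
    proof -
      obtain c where c: "\<And>i. 0 < c i" "\<And>i. c i < 1/2" "\<And>i. osc (c i) = r" "c \<longlonglongrightarrow> 0"
        using osc_sequence[OF r] by metis
      have "(\<lambda>i. Complex (\<sigma> * c i) (osc (c i))) \<longlonglongrightarrow> Complex (\<sigma> * 0) r"
        unfolding c(3) by (intro tendsto_intros c(4))
      moreover have "Complex (\<sigma> * c i) (osc (c i)) \<in> G \<sigma>" for i
        using c(1,2)[of i] by (auto simp: G_def)
      ultimately show ?thesis unfolding closure_sequential by fastforce
    qed
    then show "G \<sigma> \<union> B \<subseteq> closure (G \<sigma>)"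
      using closure_subset[of "G \<sigma>"] by (auto simp: B_def)
  qed auto
  then have "connected (G 1 \<union> B)" "connected (G (-1) \<union> B)" by auto
  moreover have "Complex 0 0 \<in> B" by (simp add: B_def)
  ultimately have "connected ((G 1 \<union> B) \<union> (G (-1) \<union> B))"
    using connected_Un[of "G 1 \<union> B" "G (-1) \<union> B"] by blast
  also have "(G 1 \<union> B) \<union> (G (-1) \<union> B) = window"
  proof (intro subset_antisym subsetI)
    fix z assume z: "z \<in> window"
    consider "Re z = 0" | "Re z > 0" | "Re z < 0" by linarith
    then show "z \<in> (G 1 \<union> B) \<union> (G (-1) \<union> B)"
    proof cases
      case 1
      then have "z = Complex 0 (Im z)" "Im z \<in> {-1..1}"
        using z by (auto simp: window_def complex_eq_iff abs_le_iff)
      then show ?thesis unfolding B_def by blast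
    next
      case 2
      then have "z = Complex (1 * Re z) (osc (Re z))" "Re z \<in> {0<..1/2}"
        using z by (auto simp: window_def complex_eq_iff)
      then show ?thesis unfolding G_def by blast
    next
      case 3
      then have "z = Complex (-1 * - Re z) (osc (- Re z))" "- Re z \<in> {0<..1/2}"
        using z by (auto simp: window_def complex_eq_iff)
      then show ?thesis unfolding G_def by blast
    qed
  qed (auto simp: window_def G_def B_def)
  finally show ?thesis .
qed

text \<open>The window meets every vertical line in a compact interval, so each point of the complement
  escapes to infinity vertically.\<close>

lemma Borsukian_window: "Borsukian window"
proof -
  \<comment> \<open>The outside of the rectangle containing the window, written as four half-planes;
    the three points below witness that they overlap in succession.\<close>
  define N where "N = {z. 1 < Im z} \<union> {z. 1/2 < Re z} \<union> {z. Im z < -1} \<union> {z. Re z < -1/2}"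
  have convex: "convex {z. a < Im z}" "convex {z. a < Re z}" "convex {z. Im z < a}"
    "convex {z. Re z < a}" for a
    by (rule convex_halfspace_Im_gt convex_halfspace_Re_gt convex_halfspace_Im_lt
        convex_halfspace_Re_lt)+
  have "Complex 1 2 \<in> {z. 1 < Im z} \<inter> {z. 1/2 < Re z}"
    "Complex 1 (-2) \<in> ({z. 1 < Im z} \<union> {z. 1/2 < Re z}) \<inter> {z. Im z < -1}"
    "Complex (-1) (-2) \<in> ({z. 1 < Im z} \<union> {z. 1/2 < Re z} \<union> {z. Im z < -1}) \<inter> {z. Re z < -1/2}"
    by auto
  then have N: "connected N"
    unfolding N_def by (intro connected_Un convex_connected convex) blast+
  have Nw: "N \<subseteq> - window" by (auto simp: N_def window_def)
  have "connected_component (- window) 2 z" if z: "z \<in> - window" for z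
  proof -
    have "\<exists>C. convex C \<and> z \<in> C \<and> C \<subseteq> - window \<and> N \<inter> C \<noteq> {}"
    proof (cases "z \<in> N")
      case True
      then show ?thesis using z by (intro exI[of _ "{z}"]) auto
    next
      case False
      then have z': "Re z \<noteq> 0" "Im z \<noteq> osc (Re z)"
        using z by (auto simp: window_def N_def)
      \<comment> \<open>Off the bar the window has only one point on the vertical line through
        \<open>z\<close>; the ray pointing away from that point avoids it.\<close>
      define \<sigma> :: real where "\<sigma> = (if osc (Re z) < Im z then 1 else -1)"
      define C where "C = {w. Re w = Re z} \<inter> {w. \<sigma> * Im z \<le> \<sigma> * Im w}"
      have "convex {w. Re w = Re z}"
        using convex_hyperplane[of "1::complex" "Re z"] by (simp add: inner_complex_def)
      moreover have "convex {w. \<sigma> * Im z \<le> \<sigma> * Im w}"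
        using convex_halfspace_Im_ge[of "Im z"] convex_halfspace_Im_le[of "Im z"]
        by (simp add: \<sigma>_def)
      ultimately have "convex C" unfolding C_def by (rule convex_Int)
      moreover have "Complex (Re z) (\<sigma> * (\<bar>Im z\<bar> + 2)) \<in> N \<inter> C"
        by (auto simp: C_def N_def \<sigma>_def)
      moreover have "z \<in> C" by (simp add: C_def)
      moreover have "C \<subseteq> - window"
        using z' by (auto simp: C_def \<sigma>_def window_def split: if_splits)
      ultimately show ?thesis by blast
    qed
    then obtain C where C: "convex C" "z \<in> C" "C \<subseteq> - window" "N \<inter> C \<noteq> {}" by blast
    then have "connected (N \<union> C)" using N convex_connected by (intro connected_Un) auto
    moreover have "2 \<in> N" by (simp add: N_def)
    ultimately show ?thesis unfolding connected_component_def using C Nw by blast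
  qed
  then have "connected (- window)"
    unfolding connected_iff_connected_component
    by (meson connected_component_sym connected_component_trans)
  \<comment> \<open>A compact plane set is Borsukian exactly if its complement is connected.\<close>
  then show ?thesis using Borsukian_separation_compact[OF compact_window] by simp
qed

section \<open>The blown-up solenoid\<close>

text \<open>The fibre over \<open>leaf n\<close> is an arc, since the coordinate \<open>s n\<close> is free there; over all other points
  of the solenoid the fibre is a single point.\<close>

definition slovak :: "((nat \<Rightarrow> complex) \<times> (int \<Rightarrow> real)) set" where
  "slovak = {(y, s). y \<in> solenoid \<and> (\<forall>n. \<bar>s n\<bar> \<le> 1) \<and>
     (\<forall>n. y \<noteq> leaf (of_int n) \<longrightarrow> s n = sin (1 / dist y (leaf (of_int n))))}"

text \<open>At \<open>y = leaf n\<close> the \<open>n\<close>-th coordinate is \<open>sin (1 / 0) = 0\<close>, the midpoint of the arc.\<close>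

definition pt :: "(nat \<Rightarrow> complex) \<Rightarrow> (nat \<Rightarrow> complex) \<times> (int \<Rightarrow> real)" where
  "pt y = (y, \<lambda>n. sin (1 / dist y (leaf (of_int n))))"

text \<open>The lift of the time-\<open>k\<close> map. Reindexing takes the arc over the integer
  \<open>n - k\<close> to the arc over \<open>n\<close>.\<close>

definition shift :: "int \<Rightarrow> (nat \<Rightarrow> complex) \<times> (int \<Rightarrow> real) \<Rightarrow> (nat \<Rightarrow> complex) \<times> (int \<Rightarrow> real)" where
  "shift k x = (flow (of_int k) (fst x), \<lambda>n. snd x (n - k))"

text \<open>The points of the solenoid with one-point fibres.\<close>

definition generic :: "(nat \<Rightarrow> complex) set" where
  "generic = solenoid - range (\<lambda>n::int. leaf (of_int n))"

text \<open>Places the window over the leaf segment around \<open>n\<close>: the imaginary part is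
  the free coordinate \<open>n\<close>, and every other coordinate is forced by the position on the
  leaf.\<close>

definition win :: "int \<Rightarrow> complex \<Rightarrow> (nat \<Rightarrow> complex) \<times> (int \<Rightarrow> real)" where
  "win n z = (leaf (of_int n + Re z), \<lambda>m. if m = n then Im z else osc (of_int n + Re z - of_int m))"

lemma fst_pt [simp]: "fst (pt y) = y"
  by (simp add: pt_def)

lemma fst_shift [simp]: "fst (shift k x) = flow (of_int k) (fst x)"
  by (simp add: shift_def)

lemma fst_win [simp]: "fst (win n z) = leaf (of_int n + Re z)"
  by (simp add: win_def)

lemma fst_in_solenoid: "x \<in> slovak \<Longrightarrow> fst x \<in> solenoid"
  by (auto simp: slovak_def)

lemma pt_in_slovak: "y \<in> solenoid \<Longrightarrow> pt y \<in> slovak"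
  by (simp add: slovak_def pt_def)

lemma eq_pt: "x \<in> slovak \<Longrightarrow> fst x \<in> generic \<Longrightarrow> x = pt (fst x)"
  by (fastforce simp: slovak_def pt_def generic_def fun_eq_iff)

lemma leaf_generic_iff [simp]: "leaf c \<in> generic \<longleftrightarrow> c \<notin> \<int>"
  by (auto simp: generic_def leaf_inj Ints_def)

lemma flow_generic_iff [simp]: "flow (of_int k) y \<in> generic \<longleftrightarrow> y \<in> generic"
proof -
  have "flow (of_int k) y \<in> range (\<lambda>n::int. leaf (of_int n)) \<longleftrightarrow> y \<in> range (\<lambda>n::int. leaf (of_int n))"
    (is "?L \<longleftrightarrow> ?R")
  proof
    assume ?L
    then obtain n :: int where "y = leaf (of_int (n - k))"
      by (auto simp: flow_eq_leaf_iff)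
    then show ?R by blast
  next
    assume ?R
    then obtain n :: int where "flow (of_int k) y = leaf (of_int (k + n))"
      by (auto simp: flow_leaf)
    then show ?L by blast
  qed
  then show ?thesis by (simp add: generic_def)
qed

lemma dist_flow_leaf: "dist (flow t y) (leaf s) = dist y (leaf (s - t))"
  using dist_flow[of t y "leaf (s - t)"] by (simp add: flow_leaf)

lemma shift_pt [simp]: "shift k (pt y) = pt (flow (of_int k) y)"
  by (simp add: shift_def pt_def dist_flow_leaf)

lemma shift_in_slovak: "x \<in> slovak \<Longrightarrow> shift k x \<in> slovak"
  by (auto simp: slovak_def shift_def dist_flow_leaf flow_eq_leaf_iff)

lemma shift_add: "shift j (shift k x) = shift (j + k) x"
  by (simp add: shift_def flow_add algebra_simps)

lemma shift_0 [simp]: "shift 0 x = x"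
  by (simp add: shift_def)

lemma shift_power: "(shift 1 ^^ n) x = shift (int n) x"
  by (induction n) (simp_all add: shift_add)

lemma continuous_on_shift: "continuous_on S (shift k)"
  unfolding shift_def
  by (intro continuous_intros continuous_on_product_then_coordinatewise[OF continuous_on_snd[OF continuous_on_id]])

lemma win_in_slovak:
  assumes "z \<in> window"
  shows "win n z \<in> slovak"
  using assms by (auto simp: slovak_def win_def window_def leaf_inj sin_dist_leaf)

lemma continuous_on_win: "continuous_on window (win n)"
proof -
  have "continuous_on window (\<lambda>z. if m = n then Im z else osc (of_int n + Re z - of_int m))" for m
  proof (cases "m = n")
    case False
    \<comment> \<open>The window reaches only 1/2 to either side, so it stays away from the
      singularity at any other integer.\<close>
    then have "\<bar>real_of_int n - of_int m\<bar> \<ge> 1" by linarith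
    then have "of_int n + Re z - of_int m \<noteq> 0" if "z \<in> window" for z
      using that by (auto simp: window_def)
    then have "continuous_on window (\<lambda>z. osc (of_int n + Re z - of_int m))"
      by (intro continuous_on_compose2[OF continuous_on_osc] continuous_intros) auto
    with False show ?thesis by simp
  qed (auto intro: continuous_intros)
  then show ?thesis unfolding win_def by (intro continuous_intros)
qed

lemma win_graph: "c \<noteq> 0 \<Longrightarrow> win n (Complex c (osc c)) = pt (leaf (of_int n + c))"
  by (auto simp: win_def pt_def sin_dist_leaf)

text \<open>Serves to pass from one window to the next along the leaf, in proofs of connectedness
  and in inductions over the integers.\<close>

lemma win_joint_in:
  "pt (leaf (of_int n + 1/2)) \<in> win n ` window \<inter> win (n + 1) ` window"
proof -
  have "win n (Complex (1/2) (osc (1/2))) = pt (leaf (of_int n + 1/2))"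
    by (rule win_graph) simp
  moreover have "win (n + 1) (Complex (-1/2) (osc (-1/2))) = pt (leaf (of_int (n + 1) + - 1/2))"
    by (rule win_graph) simp
  then have "win (n + 1) (Complex (-1/2) (osc (-1/2))) = pt (leaf (of_int n + 1/2))"
    by (simp del: osc_minus add: algebra_simps)
  moreover have "Complex (1/2) (osc (1/2)) \<in> window" "Complex (-1/2) (osc (-1/2)) \<in> window"
    by (rule graph_in_window; simp)+
  ultimately show ?thesis by (metis IntI imageI)
qed

lemma win_centre: "win n 0 = pt (leaf (of_int n))"
proof -
  have "osc 0 = 0" by (simp add: osc_def)
  then show ?thesis by (simp add: win_def pt_def sin_dist_leaf fun_eq_iff)
qed

lemma slovak_leaf_in_window:
  assumes x: "x \<in> slovak" "fst x = leaf c"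
  obtains n z where "z \<in> window" "x = win n z" "c = of_int n + Re z"
proof -
  define n where "n = round c"
  define z where "z = Complex (c - of_int n) (snd x n)"
  have "\<bar>c - of_int n\<bar> \<le> 1/2"
    using of_int_round_abs_le[of c] by (simp add: n_def abs_minus_commute)
  moreover have s: "\<bar>snd x m\<bar> \<le> 1" "c \<noteq> of_int m \<Longrightarrow> snd x m = osc (c - of_int m)" for m
    using x by (auto simp: slovak_def leaf_inj sin_dist_leaf)
  ultimately have "z \<in> window" by (simp add: window_def z_def)
  moreover have "x = win n z"
  proof (rule prod_eqI)
    show "fst x = fst (win n z)" using x(2) by (simp add: z_def)
    have "c \<noteq> of_int m" if "m \<noteq> n" for m using that by (auto simp: n_def)
    then show "snd x = snd (win n z)" using s(2) by (auto simp: win_def z_def)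
  qed
  moreover have "c = of_int n + Re z" by (simp add: z_def)
  ultimately show ?thesis using that by blast
qed

section \<open>Compactness of the extension\<close>

lemma closed_solenoid: "closed solenoid"
proof -
  have "continuous_on UNIV (\<lambda>y::nat \<Rightarrow> complex. y k)" for k
    by (rule continuous_on_product_coordinates)
  then show ?thesis
    unfolding solenoid_def by (intro closed_Collect_all closed_Collect_conj closed_Collect_eq continuous_intros)
qed

lemma closed_slovak: "closed slovak"
proof -
  have c: "continuous_on S (\<lambda>x::(nat \<Rightarrow> complex) \<times> (int \<Rightarrow> real). snd x n)" for n S
    by (rule continuous_on_product_then_coordinatewise[OF continuous_on_snd[OF continuous_on_id]])
  \<comment> \<open>The points violating the implication form an open set, because the formula is
    continuous off \<open>leaf a\<close>.\<close>
  have closed_bar: "closed {x::(nat \<Rightarrow> complex) \<times> (int \<Rightarrow> real). fst x \<noteq> leaf a \<longrightarrow> snd x n = sin (1 / dist (fst x) (leaf a))}" for a n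
  proof -
    have "open ({x::(nat \<Rightarrow> complex) \<times> (int \<Rightarrow> real). fst x \<noteq> leaf a} \<inter>
        (\<lambda>x. snd x n - sin (1 / dist (fst x) (leaf a))) -` (- {0}))" (is "open ?U")
      by (intro continuous_open_preimage continuous_intros open_Collect_neq c) auto
    moreover have "- {x. fst x \<noteq> leaf a \<longrightarrow> snd x n = sin (1 / dist (fst x) (leaf a))} = ?U"
      by auto
    ultimately show ?thesis unfolding closed_def by simp
  qed
  have closed_abs: "closed {x::(nat \<Rightarrow> complex) \<times> (int \<Rightarrow> real). \<bar>snd x n\<bar> \<le> 1}" for n
    by (intro closed_Collect_le continuous_intros c)
  have eq: "slovak = (solenoid \<times> UNIV) \<inter> {x. \<forall>n. \<bar>snd x n\<bar> \<le> 1} \<inter>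
     {x. \<forall>n. fst x \<noteq> leaf (of_int n) \<longrightarrow> snd x n = sin (1 / dist (fst x) (leaf (of_int n)))}"
    by (auto simp: slovak_def)
  show ?thesis
    unfolding eq
    by (intro closed_Int closed_Times closed_solenoid closed_UNIV closed_Collect_all closed_abs closed_bar)
qed

lemma compact_PiE_UNIV:
  fixes K :: "'a \<Rightarrow> 'b::topological_space set"
  assumes "\<And>i. compact (K i)"
  shows "compact (Pi UNIV K)"
proof -
  have "compactin (product_topology (\<lambda>_. euclidean) UNIV) (PiE UNIV K)"
    using assms by (simp add: compactin_PiE)
  then show ?thesis by (simp add: euclidean_product_topology PiE_UNIV_domain)
qed

lemma compact_slovak: "compact slovak"
proof -
  have "slovak \<subseteq> Pi UNIV (\<lambda>_. cball 0 1) \<times> Pi UNIV (\<lambda>_. cball 0 1)"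
    by (auto simp: slovak_def solenoid_def)
  moreover have "compact (Pi (UNIV::nat set) (\<lambda>_. cball (0::complex) 1) \<times> Pi (UNIV::int set) (\<lambda>_. cball (0::real) 1))"
    by (intro compact_Times compact_PiE_UNIV compact_cball)
  ultimately show ?thesis using closed_slovak
    by (metis compact_Int_closed inf.absorb_iff2)
qed

text \<open>No coordinate is free over \<open>w\<close>: each is eventually given by its formula,
  which is continuous there. Thus convergence in the solenoid lifts.\<close>

lemma tendsto_pt:
  assumes x: "\<And>j. x j \<in> slovak" and lim: "(\<lambda>j. fst (x j)) \<longlonglongrightarrow> w" and w: "w \<in> generic"
  shows "x \<longlonglongrightarrow> pt w"
proof -
  have "(\<lambda>j. snd (x j) n) \<longlonglongrightarrow> sin (1 / dist w (leaf (of_int n)))" for n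
  proof (rule Lim_transform_eventually)
    have ne: "w \<noteq> leaf (of_int n)" using w by (auto simp: generic_def)
    then show "(\<lambda>j. sin (1 / dist (fst (x j)) (leaf (of_int n)))) \<longlonglongrightarrow> sin (1 / dist w (leaf (of_int n)))"
      by (intro tendsto_intros lim) auto
    show "\<forall>\<^sub>F j in sequentially. sin (1 / dist (fst (x j)) (leaf (of_int n))) = snd (x j) n"
      using tendsto_imp_eventually_ne[OF lim ne]
    proof (rule eventually_mono)
      show "sin (1 / dist (fst (x j)) (leaf (of_int n))) = snd (x j) n" if "fst (x j) \<noteq> leaf (of_int n)" for j
        using x[of j] that by (auto simp: slovak_def)
    qed
  qed
  then have "(\<lambda>j. (fst (x j), snd (x j))) \<longlonglongrightarrow> pt w"
    unfolding pt_def by (intro tendsto_Pair lim) (simp add: tendsto_fun_iff)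
  then show ?thesis by simp
qed

text \<open>Every point of the bar can be approached horizontally from either side, since
  \<open>osc\<close> takes the value \<open>r\<close> arbitrarily close to 0.\<close>

lemma win_graph_tendsto:
  assumes "\<bar>r\<bar> \<le> 1" "\<bar>\<sigma>\<bar> = 1"
  obtains c where "\<And>i. 0 < c i" "\<And>i. c i < 1/2" "c \<longlonglongrightarrow> 0"
    "\<And>i. win n (Complex (\<sigma> * c i) r) = pt (leaf (of_int n + \<sigma> * c i))" 
    "\<And>i. Complex (\<sigma> * c i) r \<in> window"
    "(\<lambda>i. Complex (\<sigma> * c i) r) \<longlonglongrightarrow> Complex 0 r"
proof -
  obtain c where c: "\<And>i. 0 < c i" "\<And>i. c i < 1/2" "\<And>i. osc (c i) = r" "c \<longlonglongrightarrow> 0"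
    using osc_sequence[OF assms(1)] by metis
  have \<sigma>: "\<sigma> = 1 \<or> \<sigma> = -1" using assms(2) by auto
  have o: "osc (\<sigma> * c i) = r" "\<sigma> * c i \<noteq> 0" for i
    using \<sigma> c(1)[of i] c(3)[of i] by auto
  show ?thesis
  proof (rule that[OF c(1,2,4)])
    show "win n (Complex (\<sigma> * c i) r) = pt (leaf (of_int n + \<sigma> * c i))" for i
      using win_graph[OF o(2)[of i], of n] o(1)[of i] by simp
    show "Complex (\<sigma> * c i) r \<in> window" for i
      using c(1,2)[of i] o(1)[of i] assms by (simp add: window_def abs_mult)
    have "(\<lambda>i. Complex (\<sigma> * c i) r) \<longlonglongrightarrow> Complex (\<sigma> * 0) r"
      by (intro tendsto_intros c(4))
    then show "(\<lambda>i. Complex (\<sigma> * c i) r) \<longlonglongrightarrow> Complex 0 r" by simp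
  qed
qed

text \<open>A point on an arc over an integer is the limit of graph points at the same height, and
  these lie over non-integers.\<close>

lemma generic_dense: "slovak \<subseteq> closure (pt ` generic)"
proof
  fix x assume x: "x \<in> slovak"
  show "x \<in> closure (pt ` generic)"
  proof (cases "fst x \<in> generic")
    case True
    then have "x \<in> pt ` generic" by (metis eq_pt[OF x] imageI)
    then show ?thesis by (rule subsetD[OF closure_subset])
  next
    case False
    then obtain m :: int where "fst x = leaf (of_int m)"
      using fst_in_solenoid[OF x] by (auto simp: generic_def)
    then obtain n z where z: "z \<in> window" "x = win n z" "real_of_int m = of_int n + Re z"
      using slovak_leaf_in_window[OF x] by metis
    then have "\<bar>real_of_int (m - n)\<bar> \<le> 1/2" by (simp add: window_def)
    then have "m = n" by linarith
    define r where "r = Im z"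
    have xw: "x = win n (Complex 0 r)" and r: "\<bar>r\<bar> \<le> 1"
      using z \<open>m = n\<close> by (auto simp: r_def window_def win_def)
    obtain c where c: "\<And>i. 0 < c i" "\<And>i. c i < 1/2"
      "\<And>i. win n (Complex (1 * c i) r) = pt (leaf (of_int n + 1 * c i))"
      "\<And>i. Complex (1 * c i) r \<in> window"
      "(\<lambda>i. Complex (1 * c i) r) \<longlonglongrightarrow> Complex 0 r"
      by (rule win_graph_tendsto[OF r abs_one, of n]) (rule that)
    have "(\<lambda>i. win n (Complex (1 * c i) r)) \<longlonglongrightarrow> win n (Complex 0 r)"
      by (rule continuous_on_tendsto_compose[OF continuous_on_win c(5)])
        (use c(4) bar_in_window[OF r] in auto)
    then have "(\<lambda>i. pt (leaf (of_int n + c i))) \<longlonglongrightarrow> x"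
      unfolding c(3) using xw by simp
    moreover have "of_int n + c i \<notin> \<int>" for i
    proof
      assume "of_int n + c i \<in> \<int>"
      then have "c i \<in> \<int>" by (metis Ints_diff Ints_of_int add_diff_cancel_left')
      then show False using c(1,2)[of i] by (auto elim!: Ints_cases)
    qed
    ultimately show ?thesis unfolding closure_sequential
      by (intro exI[of _ "\<lambda>i. pt (leaf (of_int n + c i))"]) auto
  qed
qed

text \<open>Orbits are dense in the solenoid, and over generic points the convergence lifts; density
  of the generic points does the rest. Tails of orbits are taken so that limits along the
  approximating times can be used later.\<close>

lemma shift_orbit_dense:
  assumes x: "x \<in> slovak" and z: "z \<in> slovak"
  shows "z \<in> closure ((\<lambda>k. shift (int k) x) ` {N..})"
    and "z \<in> closure ((\<lambda>k. shift (- int k) x) ` {N..})"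
proof -
  \<comment> \<open>The sign \<epsilon> will be 1 or -1, for the two directions of time.\<close>
  have dense: "z \<in> closure ((\<lambda>k. shift (\<epsilon> * int k) x) ` {N..})"
    if "\<And>w. w \<in> solenoid \<Longrightarrow> \<exists>\<sigma>::nat \<Rightarrow> nat. (\<forall>j. j \<le> \<sigma> j) \<and> (\<lambda>j. flow (of_int \<epsilon> * real (\<sigma> j)) (fst x)) \<longlonglongrightarrow> w"
    for \<epsilon> :: int
  proof -
    have "pt w \<in> closure ((\<lambda>k. shift (\<epsilon> * int k) x) ` {N..})" if w: "w \<in> generic" for w
    proof -
      obtain \<sigma> :: "nat \<Rightarrow> nat" where \<sigma>: "\<And>j. j \<le> \<sigma> j" "(\<lambda>j. flow (of_int \<epsilon> * real (\<sigma> j)) (fst x)) \<longlonglongrightarrow> w"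
        using \<open>\<And>w. w \<in> solenoid \<Longrightarrow> _\<close> w unfolding generic_def by blast
      then have "(\<lambda>j. shift (\<epsilon> * int (\<sigma> j)) x) \<longlonglongrightarrow> pt w"
        by (intro tendsto_pt shift_in_slovak x w) simp
      then have "(\<lambda>j. shift (\<epsilon> * int (\<sigma> (j + N))) x) \<longlonglongrightarrow> pt w"
        by (rule LIMSEQ_ignore_initial_segment)
      moreover have "shift (\<epsilon> * int (\<sigma> (j + N))) x \<in> (\<lambda>k. shift (\<epsilon> * int k) x) ` {N..}" for j
        using \<sigma>(1)[of "j + N"] by auto
      ultimately show ?thesis unfolding closure_sequential
        by (intro exI[of _ "\<lambda>j. shift (\<epsilon> * int (\<sigma> (j + N))) x"]) simp
    qed
    then have "closure (pt ` generic) \<subseteq> closure ((\<lambda>k. shift (\<epsilon> * int k) x) ` {N..})"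
      by (intro closure_minimal) auto
    then show ?thesis using generic_dense z by blast
  qed
  have y: "fst x \<in> solenoid" using fst_in_solenoid[OF x] .
  have "z \<in> closure ((\<lambda>k. shift (1 * int k) x) ` {N..})"
    by (rule dense, erule flow_orbit_dense[OF y], unfold of_int_1 mult_1) blast
  then show "z \<in> closure ((\<lambda>k. shift (int k) x) ` {N..})" by simp
  have "z \<in> closure ((\<lambda>k. shift (-1 * int k) x) ` {N..})"
    by (rule dense, erule flow_orbit_dense_backward[OF y], unfold of_int_minus of_int_1 mult_minus1) blast
  then show "z \<in> closure ((\<lambda>k. shift (- int k) x) ` {N..})" by simp
qed

text \<open>Coordinate \<open>m\<close> varies continuously along the path and equals the
  oscillating profile of \<open>v - m\<close> off \<open>m\<close>, so \<open>no_crossing\<close>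
  applies to \<open>v - m\<close> and, \<open>osc\<close> being even, to
  \<open>m - v\<close>.\<close>

lemma path_no_crossing:
  fixes \<gamma> :: "real \<Rightarrow> (nat \<Rightarrow> complex) \<times> (int \<Rightarrow> real)"
  assumes S: "connected S" and \<gamma>: "continuous_on S \<gamma>" "\<gamma> ` S \<subseteq> slovak"
    and v: "continuous_on S v" "\<And>t. t \<in> S \<Longrightarrow> fst (\<gamma> t) = leaf (v t)"
    and t: "t1 \<in> S" "t2 \<in> S"
  shows "v t1 \<le> of_int m \<Longrightarrow> v t2 \<le> of_int m" "of_int m \<le> v t1 \<Longrightarrow> of_int m \<le> v t2"
proof -
  have s: "continuous_on S (\<lambda>t. snd (\<gamma> t) m)"
    by (rule continuous_on_product_then_coordinatewise[OF continuous_on_snd[OF \<gamma>(1)]])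
  have vs: "snd (\<gamma> t) m = osc (v t - of_int m)" if "t \<in> S" "v t \<noteq> of_int m" for t
  proof -
    have "\<gamma> t \<in> slovak" "fst (\<gamma> t) = leaf (v t)" using \<gamma>(2) v(2) that by auto
    then show ?thesis using that by (auto simp: slovak_def leaf_inj sin_dist_leaf)
  qed
  then have vs': "snd (\<gamma> t) m = osc (of_int m - v t)" if "t \<in> S" "v t \<noteq> of_int m" for t
    using that osc_minus[of "v t - of_int m"] by simp
  have c: "continuous_on S (\<lambda>t. v t - of_int m)" "continuous_on S (\<lambda>t. of_int m - v t)"
    by (intro continuous_intros v(1))+
  show "v t1 \<le> of_int m \<Longrightarrow> v t2 \<le> of_int m"
    using no_crossing[OF S c(1) s, of t1 t2] vs t by auto
  show "of_int m \<le> v t1 \<Longrightarrow> of_int m \<le> v t2"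
    using no_crossing[OF S c(2) s, of t1 t2] vs' t by auto
qed

text \<open>The integer \<open>\<lceil>v t1\<rceil>\<close> is a barrier for the path.\<close>

lemma path_variation:
  fixes \<gamma> :: "real \<Rightarrow> (nat \<Rightarrow> complex) \<times> (int \<Rightarrow> real)"
  assumes S: "connected S" and \<gamma>: "continuous_on S \<gamma>" "\<gamma> ` S \<subseteq> slovak"
    and v: "continuous_on S v" "\<And>t. t \<in> S \<Longrightarrow> fst (\<gamma> t) = leaf (v t)"
    and t: "t1 \<in> S" "t2 \<in> S"
  shows "v t2 \<le> v t1 + 1"
proof -
  have "v t2 \<le> of_int \<lceil>v t1\<rceil>"
    using path_no_crossing(1)[OF assms] by simp
  then show ?thesis using ceiling_correct[of "v t1"] by linarith
qed

text \<open>The windows over the nonnegative integers form a connected chain that contains a dense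
  forward orbit.\<close>

lemma connected_slovak: "connected slovak"
proof -
  define W where "W N = (\<Union>n\<le>N. win (int n) ` window)" for N :: nat
  have "connected (W N)" for N
  proof (induction N)
    case 0
    then show ?case
      by (simp add: W_def connected_continuous_image continuous_on_win connected_window)
  next
    case (Suc N)
    have "pt (leaf (of_int (int N) + 1/2)) \<in> win (int N) ` window \<inter> win (int N + 1) ` window"
      using win_joint_in .
    then have "W N \<inter> win (int (Suc N)) ` window \<noteq> {}"
      unfolding W_def by (auto simp: add.commute)
    moreover have "W (Suc N) = W N \<union> win (int (Suc N)) ` window"
      by (auto simp: W_def atMost_Suc)
    ultimately show ?case using Suc
      by (simp add: connected_Un connected_continuous_image continuous_on_win connected_window)
  qed
  moreover have "win 0 0 \<in> W N" for N
    unfolding W_def using zero_in_window by (intro UN_I[of 0]) auto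
  then have "(\<Inter>N. W N) \<noteq> {}" by blast
  ultimately have "connected (\<Union>N. W N)"
    by (intro connected_Union) auto
  moreover have "(\<Union>N. W N) \<subseteq> slovak"
    using win_in_slovak by (auto simp: W_def)
  moreover have "slovak \<subseteq> closure (\<Union>N. W N)"
  proof
    fix z assume z: "z \<in> slovak"
    have "shift (int k) (pt (leaf 0)) \<in> (\<Union>N. W N)" for k
    proof -
      have "shift (int k) (pt (leaf 0)) = win (int k) 0"
        using win_centre[of "int k"] by (simp add: flow_leaf)
      also have "\<dots> \<in> W k"
        unfolding W_def using zero_in_window by (intro UN_I[of k]) auto
      finally show ?thesis by blast
    qed
    then have "closure ((\<lambda>k. shift (int k) (pt (leaf 0))) ` {0..}) \<subseteq> closure (\<Union>N. W N)"
      by (intro closure_mono) blast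
    then show "z \<in> closure (\<Union>N. W N)"
      using shift_orbit_dense(1)[OF pt_in_slovak[OF leaf_in_solenoid[of 0]] z, of 0] by blast
  qed
  ultimately show ?thesis by (rule connected_intermediate_closure)
qed

section \<open>Minimal self-maps\<close>

lemma Borsukian_interval: "connected S \<Longrightarrow> Borsukian S" for S :: "real set"
  by (metis is_interval_connected_1 is_interval_convex_1 convex_imp_contractible contractible_imp_Borsukian)

lemma continuous_on_pt: "continuous_on generic pt"
  unfolding pt_def by (intro continuous_intros) (auto simp: generic_def)

locale minimal_self_map =
  fixes g :: "(nat \<Rightarrow> complex) \<times> (int \<Rightarrow> real) \<Rightarrow> (nat \<Rightarrow> complex) \<times> (int \<Rightarrow> real)"
  assumes cont: "continuous_on slovak g"
    and maps: "x \<in> slovak \<Longrightarrow> g x \<in> slovak"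
    and minimal: "x \<in> slovak \<Longrightarrow> slovak \<subseteq> closure (range (\<lambda>n. (g ^^ n) x))"
begin

section \<open>Invariance of the part over the leaf\<close>

lemma continuous_on_fst_g: "continuous_on slovak (\<lambda>x. fst (g x))"
  by (intro continuous_intros cont)

lemma fst_g_in_solenoid: "x \<in> slovak \<Longrightarrow> fst (g x) \<in> solenoid"
  using maps fst_in_solenoid by blast

text \<open>The image is compact and contains the dense orbit of one of its points.\<close>

lemma surj: "g ` slovak = slovak"
proof
  have x0: "pt (leaf 0) \<in> slovak" by (simp add: pt_in_slovak)
  have orbit: "(g ^^ n) x \<in> slovak" if "x \<in> slovak" for n x
    using that maps by (induction n) auto
  have "(g ^^ n) (g (pt (leaf 0))) \<in> g ` slovak" for n
    using orbit[OF x0] by (simp add: funpow_swap1[symmetric])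
  then have "closure (range (\<lambda>n. (g ^^ n) (g (pt (leaf 0))))) \<subseteq> g ` slovak"
    by (intro closure_minimal compact_imp_closed compact_continuous_image cont compact_slovak) auto
  then show "slovak \<subseteq> g ` slovak"
    using minimal[OF maps[OF x0]] by blast
qed (use maps in auto)

lemma closed_invariant_eq:
  assumes "closed A" "x \<in> A" "x \<in> slovak" "\<And>y. y \<in> A \<Longrightarrow> g y \<in> A"
  shows "slovak \<subseteq> A"
proof -
  have "(g ^^ n) x \<in> A" for n
    using assms by (induction n) auto
  then have "closure (range (\<lambda>n. (g ^^ n) x)) \<subseteq> A"
    using assms(1) by (intro closure_minimal) auto
  then show ?thesis using minimal[OF assms(3)] by blast
qed

lemma no_invariant_fibre: "\<exists>x\<in>slovak. fst x = leaf c \<and> fst (g x) \<noteq> leaf c"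
proof (rule ccontr)
  assume *: "\<not> ?thesis"
  define A where "A = {x \<in> slovak. fst x = leaf c}"
  have "closed A"
  proof -
    have "closed (slovak \<inter> fst -` {leaf c})"
      by (intro continuous_closed_preimage closed_slovak continuous_intros)
    then show ?thesis by (simp add: A_def vimage_def Int_def)
  qed
  moreover have "pt (leaf c) \<in> A" by (simp add: A_def pt_in_slovak)
  ultimately have "slovak \<subseteq> A"
    using * by (rule_tac closed_invariant_eq[of A "pt (leaf c)"]) (auto simp: A_def maps)
  then have "pt (leaf (c + 1)) \<in> A" by (auto simp: pt_in_slovak)
  then show False by (simp add: A_def leaf_inj)
qed

text \<open>Otherwise the path over the flow line of \<open>x\<close> is mapped over a leaf segment
  of radius 1 around \<open>u 0\<close>. This path is dense and the segment is compact, so the whole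
  image lies over the segment and misses \<open>leaf (u 0 + 5)\<close>, contrary to
  surjectivity.\<close>

lemma off_leaf:
  assumes x: "x \<in> slovak" and y: "fst x \<notin> range leaf"
  shows "fst (g x) \<notin> range leaf"
proof
  assume a: "fst (g x) \<in> range leaf"
  define \<gamma> where "\<gamma> t = pt (flow t (fst x))" for t
  have gen: "flow t (fst x) \<in> generic" for t
    using y fst_in_solenoid[OF x] by (auto simp: generic_def flow_eq_leaf_iff)
  have "continuous_on UNIV (\<lambda>t. flow t (fst x))" by (intro continuous_intros)
  then have \<gamma>: "continuous_on UNIV \<gamma>" "\<gamma> ` UNIV \<subseteq> slovak"
    unfolding \<gamma>_def using gen fst_in_solenoid[OF x]
    by (auto intro!: continuous_on_compose2[OF continuous_on_pt] pt_in_slovak)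
  have ptx: "pt (fst x) = x" using eq_pt[OF x] gen[of 0] by simp
  then have "\<gamma> 0 = x" by (simp add: \<gamma>_def)
  have g\<gamma>: "continuous_on UNIV (\<lambda>t. g (\<gamma> t))" "(\<lambda>t. g (\<gamma> t)) ` UNIV \<subseteq> slovak"
    using continuous_on_compose2[OF cont \<gamma>] \<gamma>(2) maps by blast+
  obtain u where u: "continuous_on UNIV u" "\<And>t. fst (g (\<gamma> t)) = leaf (u t)"
  proof (rule solenoid_lift_leaf[of UNIV "\<lambda>t. fst (g (\<gamma> t))" 0])
    show "(\<lambda>t. fst (g (\<gamma> t))) ` UNIV \<subseteq> solenoid"
      using g\<gamma>(2) fst_in_solenoid by blast
  qed (use g\<gamma> a \<open>\<gamma> 0 = x\<close> in \<open>auto intro: Borsukian_interval continuous_on_fst\<close>)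
  have bound: "u t \<in> {u 0 - 1..u 0 + 1}" for t
    using path_variation[OF connected_UNIV g\<gamma> u(1) u(2), of 0 t]
      path_variation[OF connected_UNIV g\<gamma> u(1) u(2), of t 0] by auto
  define C where "C = slovak \<inter> (\<lambda>z. fst (g z)) -` (leaf ` {u 0 - 1..u 0 + 1})"
  have "closed C"
    unfolding C_def
    by (intro continuous_closed_preimage continuous_on_fst_g closed_slovak compact_imp_closed
        compact_continuous_image continuous_intros) auto
  moreover have "shift (int k) x \<in> C" for k
  proof -
    have "shift (int k) x = \<gamma> (real k)"
      using shift_pt[of "int k" "fst x"] by (simp add: ptx \<gamma>_def)
    then show ?thesis using \<gamma>(2) bound by (auto simp: C_def u(2))
  qed
  ultimately have "closure ((\<lambda>k. shift (int k) x) ` {0..}) \<subseteq> C"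
    by (intro closure_minimal) auto
  then have "slovak \<subseteq> C" using shift_orbit_dense(1)[OF x] by blast
  moreover obtain z where "z \<in> slovak" "g z = pt (leaf (u 0 + 5))"
    using surj pt_in_slovak[OF leaf_in_solenoid[of "u 0 + 5"]] by (metis imageE)
  ultimately show False by (force simp: C_def leaf_inj)
qed

text \<open>A window is not path connected, so path lifting would not reach all of it; the Borsukian
  property takes its place.\<close>

lemma window_lift:
  assumes "z \<in> window" "fst (g (win n z)) \<in> range leaf"
  obtains u where "continuous_on window u" "\<And>z. z \<in> window \<Longrightarrow> fst (g (win n z)) = leaf (u z)"
proof (rule solenoid_lift_leaf[of window "\<lambda>z. fst (g (win n z))" z])
  show "continuous_on window (\<lambda>z. fst (g (win n z)))"
    by (rule continuous_on_compose2[OF continuous_on_fst_g continuous_on_win]) (auto intro: win_in_slovak)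
  show "(\<lambda>z. fst (g (win n z))) ` window \<subseteq> solenoid"
    using fst_g_in_solenoid win_in_slovak by blast
qed (use assms Borsukian_window connected_window that in auto)

lemma int_chain:
  fixes P :: "int \<Rightarrow> bool"
  assumes "P n" "\<And>n. P n \<longleftrightarrow> P (n + 1)"
  shows "P m"
proof (induction m rule: int_induct[of _ n])
  case (step2 i)
  then show ?case using assms(2)[of "i - 1"] by simp
qed (use assms in auto)

text \<open>Some point is mapped over \<open>leaf 0\<close>, and by \<open>off_leaf\<close> it lies
  over the leaf itself. Lifting spreads the property over its window, and the overlaps spread it to
  all windows.\<close>

lemma on_leaf:
  assumes "x \<in> slovak" "fst x \<in> range leaf"
  shows "fst (g x) \<in> range leaf"
proof -
  define P where "P n \<longleftrightarrow> (\<forall>z\<in>window. fst (g (win n z)) \<in> range leaf)" for n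
  have P: "P n" if "z \<in> window" "fst (g (win n z)) \<in> range leaf" for n z
    using window_lift[OF that] unfolding P_def by (metis rangeI)
  have "pt (leaf 0) \<in> g ` slovak"
    using surj pt_in_slovak[OF leaf_in_solenoid[of 0]] by simp
  then obtain w where w: "w \<in> slovak" "g w = pt (leaf 0)" by force
  then obtain c where "fst w = leaf c"
    using off_leaf[OF w(1)] by auto
  then obtain n z where nz: "z \<in> window" "w = win n z"
    using slovak_leaf_in_window[OF w(1)] by metis
  then have "P n" using w(2) by (intro P) auto
  moreover have "P n \<longleftrightarrow> P (n + 1)" for n
  proof -
    obtain z z' where z: "z \<in> window" "z' \<in> window" "win n z = win (n + 1) z'"
      using win_joint_in[of n] by (auto simp del: of_int_add)
    show ?thesis
    proof
      assume "P n"
      then have "fst (g (win n z)) \<in> range leaf" using z(1) by (simp only: P_def)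
      then show "P (n + 1)" using P[OF z(2), of "n + 1"] by (simp only: z(3))
    next
      assume "P (n + 1)"
      then have "fst (g (win (n + 1) z')) \<in> range leaf" using z(2) by (simp only: P_def)
      then show "P n" using P[OF z(1), of n] by (simp only: z(3))
    qed
  qed
  ultimately have "P m" for m by (rule int_chain)
  moreover obtain m z' where "z' \<in> window" "x = win m z'"
    using assms slovak_leaf_in_window[OF assms(1)] by blast
  ultimately show ?thesis by (auto simp: P_def)
qed

definition u where "u x = inv leaf (fst (g x))"

lemma inj_leaf: "inj leaf"
  by (simp add: inj_def leaf_inj)

lemma leaf_u: "x \<in> slovak \<Longrightarrow> fst x \<in> range leaf \<Longrightarrow> leaf (u x) = fst (g x)"
  unfolding u_def using on_leaf by (simp add: f_inv_into_f)

lemma u_eqI: "fst (g x) = leaf a \<Longrightarrow> u x = a"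
  by (simp add: u_def inv_f_f inj_leaf)

text \<open>The inverse of \<open>leaf\<close> is not continuous on the leaf as a subset of the
  solenoid. Continuity comes from a lift, which equals \<open>u\<close> because \<open>leaf\<close>
  is injective.\<close>

lemma continuous_on_u_win: "continuous_on window (\<lambda>z. u (win n z))"
proof -
  have "fst (g (win n 0)) \<in> range leaf"
    by (intro on_leaf win_in_slovak zero_in_window) auto
  then obtain v where "continuous_on window v" "\<And>z. z \<in> window \<Longrightarrow> fst (g (win n z)) = leaf (v z)"
    using window_lift[OF zero_in_window] by metis
  moreover from this have "u (win n z) = v z" if "z \<in> window" for z
    using that by (simp add: u_eqI)
  ultimately show ?thesis by (simp cong: continuous_on_cong)
qed

definition disp where "disp x = u x - inv leaf (fst x)"

lemma disp_eq: "fst x = leaf c \<Longrightarrow> disp x = u x - c"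
  by (simp add: disp_def inv_f_f inj_leaf)

lemma continuous_on_disp_win: "continuous_on window (\<lambda>z. disp (win n z))"
proof -
  have "disp (win n z) = u (win n z) - (of_int n + Re z)" for z
    by (simp add: disp_eq)
  then show ?thesis by (simp add: continuous_intros continuous_on_u_win)
qed

text \<open>A point with zero displacement stays in its fibre, and then so does the entire fibre: it
  is a single point, or an arc over an integer whose image, being a path, cannot leave that integer.
  This contradicts \<open>no_invariant_fibre\<close>.\<close>

lemma disp_nonzero:
  assumes x: "x \<in> slovak" "fst x \<in> range leaf"
  shows "disp x \<noteq> 0"
proof
  assume d: "disp x = 0"
  obtain c where c: "fst x = leaf c" using x(2) by blast
  then have uc: "u x = c" using d by (simp add: disp_eq)
  have "fst (g x') = leaf c" if x': "x' \<in> slovak" "fst x' = leaf c" for x'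
  proof (cases "leaf c \<in> generic")
    case True
    then have "x' = x" using eq_pt x x' c by metis
    then show ?thesis using leaf_u[OF x] uc by simp
  next
    case False
    then obtain m :: int where m: "c = of_int m" by (auto elim: Ints_cases)
    have bar: "\<exists>r. \<bar>r\<bar> \<le> 1 \<and> y = win m (Complex 0 r)" if y: "y \<in> slovak" "fst y = leaf c" for y
    proof -
      obtain n z where z: "z \<in> window" "y = win n z" "real_of_int m = of_int n + Re z"
        using slovak_leaf_in_window[OF y] m by metis
      then have "\<bar>real_of_int (m - n)\<bar> \<le> 1/2" by (simp add: window_def)
      then have "m = n" by linarith
      then show ?thesis using z by (intro exI[of _ "Im z"]) (auto simp: window_def win_def)
    qed
    define \<gamma> where "\<gamma> r = g (win m (Complex 0 r))" for r
    define v where "v r = u (win m (Complex 0 r))" for r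
    have cC: "continuous_on {-1..1} (Complex 0)" "Complex 0 ` {-1..1} \<subseteq> window"
      unfolding Complex_eq by (intro continuous_intros) (auto simp: window_def)
    have in_w: "win m (Complex 0 r) \<in> slovak" if "r \<in> {-1..1}" for r
      using cC(2) that by (intro win_in_slovak) auto
    have 1: "continuous_on {-1..1} \<gamma>" unfolding \<gamma>_def
      by (rule continuous_on_compose2[OF cont continuous_on_compose2[OF continuous_on_win cC]])
        (use in_w in auto)
    have 2: "\<gamma> ` {-1..1} \<subseteq> slovak"
      unfolding \<gamma>_def using in_w maps by blast
    have 3: "continuous_on {-1..1} v" unfolding v_def
      by (rule continuous_on_compose2[OF continuous_on_u_win cC])
    have 4: "fst (\<gamma> r) = leaf (v r)" if "r \<in> {-1..1}" for r
      unfolding \<gamma>_def v_def using leaf_u[OF in_w[OF that]] by simp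
    obtain r r' where r: "\<bar>r\<bar> \<le> 1" "x = win m (Complex 0 r)" "\<bar>r'\<bar> \<le> 1" "x' = win m (Complex 0 r')"
      using bar x(1) c x' by metis
    then have "v r = of_int m" "r \<in> {-1..1}" "r' \<in> {-1..1}" using uc m by (auto simp: v_def)
    \<comment> \<open>The barrier at \<open>m\<close> acts from both sides on a path that starts at
      \<open>m\<close>.\<close>
    then have "v r' = of_int m"
      using path_no_crossing[OF _ 1 2 3 4, of r r' m] by (intro antisym) auto
    then show ?thesis using leaf_u[OF x'(1)] x'(2) r(4) m by (simp add: v_def)
  qed
  then show False using no_invariant_fibre[of c] by blast
qed

text \<open>The displacement is continuous and nonzero on each connected window, and consecutive
  windows share a point.\<close>

lemma disp_sign: "(\<forall>n. disp (pt (leaf (of_int n))) > 0) \<or> (\<forall>n. disp (pt (leaf (of_int n))) < 0)"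
proof -
  define P where "P n \<longleftrightarrow> (\<forall>z\<in>window. disp (win n z) > 0)" for n
  have P: "P n" if "z \<in> window" "disp (win n z) > 0" for n z
    unfolding P_def
  proof (rule ccontr)
    assume "\<not> (\<forall>z\<in>window. disp (win n z) > 0)"
    then obtain z' where z': "z' \<in> window" "disp (win n z') \<le> 0" by force
    have "connected ((\<lambda>z. disp (win n z)) ` window)"
      by (intro connected_continuous_image continuous_on_disp_win connected_window)
    then have "0 \<in> (\<lambda>z. disp (win n z)) ` window"
      using z' that connectedD_interval[of _ "disp (win n z')" "disp (win n z)" 0] by (simp add: less_imp_le)
    then show False using disp_nonzero win_in_slovak by fastforce
  qed
  have step: "P n \<longleftrightarrow> P (n + 1)" for n
  proof -
    obtain z z' where z: "z \<in> window" "z' \<in> window" "win n z = win (n + 1) z'"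
      using win_joint_in[of n] by (auto simp del: of_int_add)
    show ?thesis
    proof
      assume "P n"
      then have "disp (win n z) > 0" using z(1) by (simp only: P_def)
      then show "P (n + 1)" using P[OF z(2), of "n + 1"] by (simp only: z(3))
    next
      assume "P (n + 1)"
      then have "disp (win (n + 1) z') > 0" using z(2) by (simp only: P_def)
      then show "P n" using P[OF z(1), of n] by (simp only: z(3))
    qed
  qed
  have all: "P n \<Longrightarrow> P m" for n m
    using int_chain[of P n m] step by blast
  have c: "disp (pt (leaf (of_int n))) > 0 \<longleftrightarrow> P n" for n
    using P[OF zero_in_window, of n] zero_in_window unfolding P_def by (metis win_centre)
  have "disp (pt (leaf (of_int n))) \<noteq> 0" for n :: int
    by (rule disp_nonzero) (auto simp: pt_in_slovak)
  then show ?thesis using c all by (meson linorder_neqE_linordered_idom)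
qed

section \<open>Monotonicity and limit of the displacement\<close>

lemma open_arc:
  fixes n :: int
  defines "S \<equiv> {real_of_int n<..<of_int n + 1}"
  shows "continuous_on S (\<lambda>c. g (pt (leaf c)))" "(\<lambda>c. g (pt (leaf c))) ` S \<subseteq> slovak"
proof -
  have "S \<inter> \<int> = {}" by (auto simp: S_def elim!: Ints_cases)
  then show "continuous_on S (\<lambda>c. g (pt (leaf c)))"
    by (intro continuous_on_compose2[OF cont] continuous_on_compose2[OF continuous_on_pt]
        continuous_intros) (auto simp: pt_in_slovak)
qed (auto simp: pt_in_slovak maps)

text \<open>Over the open interval between consecutive integers the image is a path, so
  \<open>path_variation\<close> bounds its advance by 1. The bound passes to the limit at both
  ends.\<close>

lemma u_step: "u (pt (leaf (of_int (n + 1)))) \<le> u (pt (leaf (of_int n))) + 1"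
proof -
  define S where "S = {real_of_int n<..<of_int n + 1}"
  define \<gamma> where "\<gamma> c = g (pt (leaf c))" for c
  define v where "v c = u (pt (leaf c))" for c
  have S: "connected S" by (simp add: S_def)
  have \<gamma>: "continuous_on S \<gamma>" "\<gamma> ` S \<subseteq> slovak"
    using open_arc[of n] by (simp_all add: \<gamma>_def S_def)
  have v: "fst (\<gamma> c) = leaf (v c)" for c
    unfolding \<gamma>_def v_def by (rule leaf_u[symmetric]) (auto simp: pt_in_slovak)
  have contv: "continuous_on S v"
  proof (rule solenoid_lift_leaf[of S "\<lambda>c. fst (\<gamma> c)" "of_int n + 1/2"])
    fix w assume w: "continuous_on S w" "\<And>c. c \<in> S \<Longrightarrow> fst (\<gamma> c) = leaf (w c)"
    then have "w c = v c" if "c \<in> S" for c using v that by (metis leaf_inj)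
    then show "continuous_on S v" using w(1) by (simp cong: continuous_on_cong)
  next
    show "(\<lambda>c. fst (\<gamma> c)) ` S \<subseteq> solenoid" using \<gamma>(2) fst_in_solenoid by blast
    show "Borsukian S" using S by (rule Borsukian_interval)
    show "continuous_on S (\<lambda>c. fst (\<gamma> c))" by (rule continuous_on_fst[OF \<gamma>(1)])
  qed (use S v in \<open>auto simp: S_def\<close>)
  \<comment> \<open>Both ends are approached at height 0, that is towards the midpoints of the arcs,
    which are the points \<open>pt (leaf n)\<close> and \<open>pt (leaf (n + 1))\<close>.\<close>
  obtain c where c: "\<And>i. 0 < c i" "\<And>i. c i < 1/2"
      "\<And>i. win n (Complex (1 * c i) 0) = pt (leaf (of_int n + 1 * c i))"
      "\<And>i. Complex (1 * c i) 0 \<in> window" "(\<lambda>i. Complex (1 * c i) 0) \<longlonglongrightarrow> Complex 0 0"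
    by (rule win_graph_tendsto[of 0 1 n]) (simp, simp, rule that)
  obtain c' where c': "\<And>i. 0 < c' i" "\<And>i. c' i < 1/2"
      "\<And>i. win (n + 1) (Complex (-1 * c' i) 0) = pt (leaf (of_int (n + 1) + -1 * c' i))"
      "\<And>i. Complex (-1 * c' i) 0 \<in> window" "(\<lambda>i. Complex (-1 * c' i) 0) \<longlonglongrightarrow> Complex 0 0"
    by (rule win_graph_tendsto[of 0 "-1" "n + 1"]) (simp, simp, rule that)
  have lim: "(\<lambda>i. u (win m (z i))) \<longlonglongrightarrow> u (pt (leaf (of_int m)))"
    if "\<And>i. z i \<in> window" "z \<longlonglongrightarrow> Complex 0 0" for z m
    using continuous_on_tendsto_compose[OF continuous_on_u_win that(2), of m] that(1) zero_in_window
    by (simp add: win_centre flip: zero_complex.code)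
  have l1: "(\<lambda>i. v (of_int n + c i) + 1) \<longlonglongrightarrow> u (pt (leaf (of_int n))) + 1"
    using lim[OF c(4,5), of n] unfolding c(3) v_def by (intro tendsto_intros) simp
  have l2: "(\<lambda>i. v (of_int (n + 1) - c' i)) \<longlonglongrightarrow> u (pt (leaf (of_int (n + 1))))"
    using lim[OF c'(4,5), of "n + 1"] unfolding c'(3) v_def by simp
  have "v (of_int (n + 1) - c' i) \<le> v (of_int n + c i) + 1" for i
    using c(1,2)[of i] c'(1,2)[of i]
    by (intro path_variation[OF S \<gamma> contv v]) (auto simp: S_def)
  then show ?thesis using LIMSEQ_le[OF l2 l1] by auto
qed

lemma disp_step: "disp (pt (leaf (of_int (n + 1)))) \<le> disp (pt (leaf (of_int n)))"
  using u_step[of n] disp_eq[of "pt (leaf (of_int (n + 1)))" "of_int (n + 1)"]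
    disp_eq[of "pt (leaf (of_int n))" "of_int n"] by simp

text \<open>At integer points \<open>g\<close> acts below as the flow for the time
  \<open>disp\<close>. Each \<open>x\<close> is a limit of integer points far along the sequence,
  and there the displacement tends to \<open>l\<close>.\<close>

lemma flow_of_limit:
  fixes \<kappa> :: "nat \<Rightarrow> int"
  assumes dense: "\<And>N. x \<in> closure ((\<lambda>k. shift (\<kappa> k) (pt (leaf 0))) ` {N..})"
    and lim: "(\<lambda>k. disp (pt (leaf (of_int (\<kappa> k))))) \<longlonglongrightarrow> l"
    and x: "x \<in> slovak"
  shows "fst (g x) = flow l (fst x)"
proof -
  have "\<exists>k\<ge>i. dist (shift (\<kappa> k) (pt (leaf 0))) x < 1 / (real i + 1)" for i
    using dense[of i] unfolding closure_approachable by (force dest: spec[of _ "1 / (real i + 1)"])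
  then obtain \<sigma> where \<sigma>: "\<And>i. i \<le> \<sigma> i" "\<And>i. dist (shift (\<kappa> (\<sigma> i)) (pt (leaf 0))) x < 1 / (real i + 1)"
    by metis
  define b where "b i = pt (leaf (of_int (\<kappa> (\<sigma> i))))" for i
  have b: "b i \<in> slovak" for i by (simp add: b_def pt_in_slovak)
  have "b \<longlonglongrightarrow> x"
  proof (rule metric_tendsto_imp_tendsto[of "\<lambda>i. 1 / (real i + 1)" 0])
    show "(\<lambda>i. 1 / (real i + 1)) \<longlonglongrightarrow> 0" by real_asymp
    show "\<forall>\<^sub>F i in sequentially. dist (b i) x \<le> dist (1 / (real i + 1)) 0"
      using less_imp_le[OF \<sigma>(2)] by (intro always_eventually) (simp add: b_def flow_leaf)
  qed
  have "filterlim \<sigma> at_top sequentially"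
    using \<sigma>(1) by (intro filterlim_at_top_mono[OF filterlim_ident]) auto
  then have "(\<lambda>i. disp (b i)) \<longlonglongrightarrow> l"
    unfolding b_def by (rule filterlim_compose[OF lim])
  then have "(\<lambda>i. flow (disp (b i)) (fst (b i))) \<longlonglongrightarrow> flow l (fst x)"
    by (rule tendsto_flow) (intro tendsto_intros \<open>b \<longlonglongrightarrow> x\<close>)
  moreover have "flow (disp (b i)) (fst (b i)) = fst (g (b i))" for i
    using leaf_u[OF b] by (simp add: b_def disp_eq flow_leaf)
  moreover have "(\<lambda>i. fst (g (b i))) \<longlonglongrightarrow> fst (g x)"
    using continuous_on_tendsto_compose[OF continuous_on_fst_g \<open>b \<longlonglongrightarrow> x\<close> x] b by simp
  ultimately show ?thesis using LIMSEQ_unique by fastforce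
qed

lemma is_translation: "\<exists>l. \<forall>x\<in>slovak. fst (g x) = flow l (fst x)"
proof -
  have p0: "pt (leaf 0) \<in> slovak" by (simp add: pt_in_slovak)
  let ?d = "\<lambda>n. disp (pt (leaf (of_int n)))"
  \<comment> \<open>The sign selects the end of the leaf: positive displacements decrease forwards
    and are bounded below by 0, negative ones increase backwards and are bounded above by 0.\<close>
  from disp_sign show ?thesis
  proof
    assume pos: "\<forall>n. ?d n > 0"
    have "decseq (\<lambda>k. ?d (int k))"
      using disp_step[of "int _"] by (intro decseq_SucI) (simp add: add.commute)
    then obtain l where "(\<lambda>k. ?d (int k)) \<longlonglongrightarrow> l"
      using decseq_convergent[of "\<lambda>k. ?d (int k)" 0] pos by (metis less_imp_le)
    then show ?thesis
      using flow_of_limit[of _ "\<lambda>k. int k" l] shift_orbit_dense(1)[OF p0] by blast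
  next
    assume neg: "\<forall>n. ?d n < 0"
    have "incseq (\<lambda>k. ?d (- int k))"
      using disp_step[of "- int (Suc _)"] by (intro incseq_SucI) simp
    then obtain l where "(\<lambda>k. ?d (- int k)) \<longlonglongrightarrow> l"
      using incseq_convergent[of "\<lambda>k. ?d (- int k)" 0] neg by (metis less_imp_le)
    then show ?thesis
      using flow_of_limit[of _ "\<lambda>k. - int k" l] shift_orbit_dense(2)[OF p0] by blast
  qed
qed

lemma is_shift: "\<exists>k. \<forall>x\<in>slovak. g x = shift k x"
proof -
  obtain l where l: "\<And>x. x \<in> slovak \<Longrightarrow> fst (g x) = flow l (fst x)"
    using is_translation by blast
  \<comment> \<open>For non-integer \<open>l\<close> the open arc over \<open>(0, 1)\<close> would
    be carried over \<open>(l, l + 1)\<close>, across the integer \<open>m\<close> inside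
    it.\<close>
  have "l \<in> \<int>"
  proof (rule ccontr)
    assume "l \<notin> \<int>"
    define m where "m = \<lceil>l\<rceil>"
    have m: "l < of_int m" "of_int m < l + 1"
      using \<open>l \<notin> \<int>\<close> ceiling_correct[of l] unfolding m_def
      by (metis Ints_of_int le_less, linarith)
    define S where "S = {real_of_int 0<..<of_int 0 + 1}"
    have S: "connected S" unfolding S_def by simp
    have v: "continuous_on S (\<lambda>c. l + c)" by (intro continuous_intros)
    have "fst (g (pt (leaf c))) = leaf (l + c)" for c
      using l[OF pt_in_slovak[OF leaf_in_solenoid]] by (simp add: flow_leaf)
    \<comment> \<open>The two parameters lie in \<open>(0, 1)\<close> on either side of
      \<open>m - l\<close>, the one sent to \<open>m\<close>.\<close>
    then have "l + (of_int m - l + 1) / 2 \<le> of_int m"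
      using path_no_crossing(1)[OF S open_arc[of 0, folded S_def] v, of "(of_int m - l) / 2" "(of_int m - l + 1) / 2" m] m
      by (simp add: S_def field_simps)
    then show False using m by (simp add: field_simps)
  qed
  then obtain k where k: "l = of_int k" by (auto elim: Ints_cases)
  \<comment> \<open>One-point fibres force \<open>g\<close> and \<open>shift k\<close> to agree over
    generic points, and the set where they agree is closed.\<close>
  define E where "E = {x \<in> slovak. g x = shift k x}"
  have "closed E"
  proof -
    have "closed (slovak \<inter> (\<lambda>x. dist (g x) (shift k x)) -` {0})"
      by (intro continuous_closed_preimage closed_slovak continuous_intros cont continuous_on_shift)
    then show ?thesis by (simp add: E_def vimage_def Int_def)
  qed
  moreover have "pt y \<in> E" if y: "y \<in> generic" for y
  proof -
    have p: "pt y \<in> slovak" using y by (simp add: pt_in_slovak generic_def)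
    have "fst (g (pt y)) = flow (of_int k) y" using l[OF p] k by simp
    then have "g (pt y) = pt (flow (of_int k) y)"
      using eq_pt[OF maps[OF p]] y by simp
    then show ?thesis using p by (simp add: E_def)
  qed
  ultimately have "closure (pt ` generic) \<subseteq> E"
    by (intro closure_minimal) auto
  then show ?thesis using generic_dense unfolding E_def by blast
qed

end

text \<open>A path joining the points over 1/2 and 3/2 would lift to the leaf and cross the integer
  1. This distinguishes the space from the circle.\<close>

lemma not_path_connected_slovak: "\<not> path_connected slovak"
proof
  assume "path_connected slovak"
  moreover have "pt (leaf (1/2)) \<in> slovak" "pt (leaf (3/2)) \<in> slovak"
    by (simp_all add: pt_in_slovak)
  ultimately obtain p where p: "path p" "path_image p \<subseteq> slovak"
      "pathstart p = pt (leaf (1/2))" "pathfinish p = pt (leaf (3/2))"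
    unfolding path_connected_def by metis
  then have c: "continuous_on {0..1} p" "p ` {0..1} \<subseteq> slovak"
    by (auto simp: path_def path_image_def)
  have ends: "p 0 = pt (leaf (1/2))" "p 1 = pt (leaf (3/2))"
    using p by (auto simp: pathstart_def pathfinish_def)
  obtain v where v: "continuous_on {0..1} v" "\<And>t. t \<in> {0..1} \<Longrightarrow> fst (p t) = leaf (v t)"
  proof (rule solenoid_lift_leaf[of "{0..1}" "\<lambda>t. fst (p t)" 0])
    show "(\<lambda>t. fst (p t)) ` {0..1} \<subseteq> solenoid" using c(2) fst_in_solenoid by blast
  qed (use c ends in \<open>auto intro: Borsukian_interval continuous_on_fst\<close>)
  then have "v 0 = 1/2" "v 1 = 3/2"
    using v(2)[of 0] v(2)[of 1] ends by (simp_all add: leaf_inj)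
  then show False
    using path_no_crossing(1)[OF _ c v, of 0 1 1] by simp
qed

section \<open>Transport to the type of points\<close>

lemma minimal_map_conjugate:
  assumes hom: "homeomorphic_maps X Y f h" and T: "minimal_map X T"
  shows "minimal_map Y (f \<circ> T \<circ> h)"
  unfolding minimal_map_def
proof (intro conjI ballI)
  have f: "continuous_map X Y f" "homeomorphic_map X Y f" and h: "continuous_map Y X h"
    and hf: "\<And>x. x \<in> topspace X \<Longrightarrow> h (f x) = x"
    using hom by (auto simp: homeomorphic_maps_def homeomorphic_map_maps)
  have contT: "continuous_map X X T" using T by (simp add: minimal_map_def)
  then show "continuous_map Y Y (f \<circ> T \<circ> h)"
    by (intro continuous_map_compose[OF h] continuous_map_compose[OF _ f(1)])
  fix y assume "y \<in> topspace Y"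
  then have y: "h y \<in> topspace X" "f (h y) = y"
    using h hom by (auto simp: continuous_map_def homeomorphic_maps_def)
  have orbit: "(T ^^ n) (h y) \<in> topspace X" for n
    using y(1) contT by (induction n) (auto simp: continuous_map_def)
  have "((f \<circ> T \<circ> h) ^^ n) y = f ((T ^^ n) (h y))" for n
    using y(2) hf[OF orbit] by (induction n) auto
  then have "range (\<lambda>n. ((f \<circ> T \<circ> h) ^^ n) y) = f ` range (\<lambda>n. (T ^^ n) (h y))"
    by auto
  moreover have "range (\<lambda>n. (T ^^ n) (h y)) \<subseteq> topspace X" using orbit by blast
  then have "Y closure_of (f ` range (\<lambda>n. (T ^^ n) (h y))) = f ` topspace X"
    using homeomorphic_map_closure_of[OF f(2)] T y(1) by (simp add: minimal_map_def)
  ultimately show "Y closure_of range (\<lambda>n. ((f \<circ> T \<circ> h) ^^ n) y) = topspace Y"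
    using f(2) by (simp add: homeomorphic_imp_surjective_map)
qed

lemma homeomorphic_map_conjugate:
  assumes hom: "homeomorphic_maps X Y f h" and T: "homeomorphic_map X X T"
  shows "homeomorphic_map Y Y (f \<circ> T \<circ> h)"
  using hom T unfolding homeomorphic_maps_map
  by (intro homeomorphic_map_compose[of Y X h] homeomorphic_map_compose[of X X T]) auto

lemma space_type_eqI:
  assumes hom: "homeomorphic_maps X Y f h"
    and ex: "minimal_map X T" "homeomorphic_map X X T"
    and all: "\<And>g. minimal_map X g \<Longrightarrow> homeomorphic_map X X g"
  shows "space_type Y = (1, 0)"
proof -
  have "admits_minimal_homeomorphism Y"
    unfolding admits_minimal_homeomorphism_def
    using minimal_map_conjugate[OF hom ex(1)] homeomorphic_map_conjugate[OF hom ex(2)] by blast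
  moreover have "homeomorphic_map Y Y g" if g: "minimal_map Y g" for g
  proof (rule homeomorphic_map_eq)
    have hom': "homeomorphic_maps Y X h f" using homeomorphic_maps_sym hom by blast
    show "homeomorphic_map Y Y (f \<circ> (h \<circ> g \<circ> f) \<circ> h)"
      by (rule homeomorphic_map_conjugate[OF hom all[OF minimal_map_conjugate[OF hom' g]]])
    show "(f \<circ> (h \<circ> g \<circ> f) \<circ> h) y = g y" if "y \<in> topspace Y" for y
    proof -
      have "g y \<in> topspace Y"
        using g that by (auto simp: minimal_map_def continuous_map_def)
      then show ?thesis using hom that by (simp add: homeomorphic_maps_def)
    qed
  qed
  then have "\<not> admits_minimal_noninvertible_map Y"
    unfolding admits_minimal_noninvertible_map_def by blast
  ultimately show ?thesis by (simp add: space_type_def)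
qed

text \<open>The metric is carried over along the inverse of \<open>f\<close>, which makes
  \<open>f\<close> an isometry.\<close>

lemma metric_transport:
  fixes S :: "'a::metric_space set" and f :: "'a \<Rightarrow> 'b"
  assumes "inj_on f S"
  obtains d where "Metric_space (f ` S) d"
    "homeomorphic_map (top_of_set S) (Metric_space.mtopology (f ` S) d) f"
proof -
  define h where "h = inv_into S f"
  define d where "d a b = dist (h a) (h b)" for a b
  have hf: "h (f x) = x" if "x \<in> S" for x using that assms by (simp add: h_def)
  have d: "Metric_space (f ` S) d"
    by unfold_locales (auto simp: d_def hf dist_commute dist_triangle)
  have sub: "Submetric UNIV dist S" by unfold_locales auto
  then have S: "Metric_space S dist" "Metric_space.mtopology S dist = top_of_set S"
    using Submetric.mtopology_submetric[OF sub]
    by (auto simp: Met_TC.subspace)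
  have "Metric_space12 S dist (f ` S) d"
    using S(1) d by (simp add: Metric_space12_def)
  then have "homeomorphic_map (top_of_set S) (Metric_space.mtopology (f ` S) d) f"
    using Metric_space12.isometry_imp_homeomorphic_map[of S dist "f ` S" d f] S(2)
    by (simp add: d_def hf)
  with d that show ?thesis by blast
qed

text \<open>A point has countably many real coordinates, which are listed in one sequence by a
  coding of the index type \<open>nat + nat + int\<close>.\<close>

lemma inj_into_point: "\<exists>\<iota> :: (nat \<Rightarrow> complex) \<times> (int \<Rightarrow> real) \<Rightarrow> point. inj \<iota>"
proof
  let ?\<iota> = "\<lambda>x k. case (from_nat k :: nat + nat + int) of Inl n \<Rightarrow> Re (fst x n)
    | Inr (Inl n) \<Rightarrow> Im (fst x n) | Inr (Inr n) \<Rightarrow> snd x n"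
  show "inj (?\<iota> :: (nat \<Rightarrow> complex) \<times> (int \<Rightarrow> real) \<Rightarrow> point)"
  proof (rule injI)
    fix x y :: "(nat \<Rightarrow> complex) \<times> (int \<Rightarrow> real)"
    assume eq: "?\<iota> x = ?\<iota> y"
    have "Re (fst x n) = Re (fst y n)" "Im (fst x n) = Im (fst y n)" for n
      using fun_cong[OF eq, of "to_nat (Inl n :: nat + nat + int)"]
        fun_cong[OF eq, of "to_nat (Inr (Inl n) :: nat + nat + int)"] by simp_all
    moreover have "snd x n = snd y n" for n
      using fun_cong[OF eq, of "to_nat (Inr (Inr n) :: nat + nat + int)"] by simp
    ultimately show "x = y" by (simp add: prod_eq_iff fun_eq_iff complex_eq_iff)
  qed
qed

lemma minimal_map_top_of_set:
  "minimal_map (top_of_set S) T \<longleftrightarrow>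
    continuous_on S T \<and> T ` S \<subseteq> S \<and> (\<forall>x\<in>S. S \<subseteq> closure (range (\<lambda>n. (T ^^ n) x)))"
proof -
  have "top_of_set S closure_of range (\<lambda>n. (T ^^ n) x) = S \<longleftrightarrow> S \<subseteq> closure (range (\<lambda>n. (T ^^ n) x))"
    if "T ` S \<subseteq> S" "x \<in> S" for x
  proof -
    have "(T ^^ n) x \<in> S" for n using that by (induction n) auto
    then have "S \<inter> range (\<lambda>n. (T ^^ n) x) = range (\<lambda>n. (T ^^ n) x)" by auto
    then show ?thesis by (auto simp: closure_of_subtopology)
  qed
  then show ?thesis
    by (auto simp: minimal_map_def image_subset_iff_funcset)
qed

lemma homeomorphic_map_shift: "homeomorphic_map (top_of_set slovak) (top_of_set slovak) (shift k)"
  unfolding homeomorphic_map_maps homeomorphic_maps_def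
  by (intro exI[of _ "shift (- k)"]) (simp add: continuous_on_shift shift_in_slovak shift_add)

lemma minimal_map_shift: "minimal_map (top_of_set slovak) (shift 1)"
  unfolding minimal_map_top_of_set shift_power
  using shift_orbit_dense(1)[of _ _ 0]
  by (auto simp: continuous_on_shift shift_in_slovak subset_iff)

lemma minimal_map_slovak_homeomorphic:
  assumes "minimal_map (top_of_set slovak) g"
  shows "homeomorphic_map (top_of_set slovak) (top_of_set slovak) g"
proof -
  interpret minimal_self_map g
    using assms unfolding minimal_map_top_of_set by unfold_locales blast+
  obtain k where "\<And>x. x \<in> slovak \<Longrightarrow> g x = shift k x" using is_shift by blast
  then show ?thesis by (intro homeomorphic_map_eq[OF homeomorphic_map_shift[of k]]) simp
qed

theorem corollary3:
  "\<exists>(M :: point set) (d :: point \<Rightarrow> point \<Rightarrow> real).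
     non_degenerate_continuum M d \<and>
     space_type (Metric_space.mtopology M d) = (1, 0) \<and>
     \<not> Metric_space.mtopology M d homeomorphic_space top_of_set (sphere (0 :: complex) 1)"
proof -
  obtain \<iota> :: "(nat \<Rightarrow> complex) \<times> (int \<Rightarrow> real) \<Rightarrow> point" where \<iota>: "inj \<iota>"
    using inj_into_point by blast
  then have inj: "inj_on \<iota> slovak" by (rule inj_on_subset) simp
  define M where "M = \<iota> ` slovak"
  obtain d where d: "Metric_space M d"
      "homeomorphic_map (top_of_set slovak) (Metric_space.mtopology M d) \<iota>"
    using metric_transport[OF inj] unfolding M_def by blast
  let ?X = "Metric_space.mtopology M d"
  have hs: "top_of_set slovak homeomorphic_space ?X"
    using d(2) homeomorphic_map_imp_homeomorphic_space by blast
  have "compact_space ?X" "connected_space ?X" "\<not> path_connected_space ?X"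
    using homeomorphic_compact_space[OF hs] homeomorphic_connected_space[OF hs]
      homeomorphic_path_connected_space[OF hs] compact_slovak connected_slovak not_path_connected_slovak
    by (simp_all add: compact_space_subtopology connected_space_subtopology)
  moreover have "path_connected_space (top_of_set (sphere (0 :: complex) 1))"
    using path_connected_sphere[of "0::complex" 1] by simp
  then have "\<not> ?X homeomorphic_space top_of_set (sphere (0 :: complex) 1)"
    using \<open>\<not> path_connected_space ?X\<close> homeomorphic_path_connected_space by blast
  moreover have "space_type ?X = (1, 0)"
  proof -
    obtain h where "homeomorphic_maps (top_of_set slovak) ?X \<iota> h"
      using d(2) by (auto simp: homeomorphic_map_maps)
    then show ?thesis
      using space_type_eqI minimal_map_shift homeomorphic_map_shift minimal_map_slovak_homeomorphic
      by blast
  qed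
  moreover have "\<iota> (pt (leaf 0)) \<in> M" "\<iota> (pt (leaf 1)) \<in> M"
    by (simp_all add: M_def pt_in_slovak)
  moreover have "\<iota> (pt (leaf 0)) \<noteq> \<iota> (pt (leaf 1))"
    using injD[OF \<iota>, of "pt (leaf 0)" "pt (leaf 1)"] by (metis fst_pt leaf_inj zero_neq_one)
  ultimately have "non_degenerate_continuum M d \<and> space_type ?X = (1, 0) \<and>
      \<not> ?X homeomorphic_space top_of_set (sphere (0 :: complex) 1)"
    unfolding non_degenerate_continuum_def continuum_def using d(1) by blast
  then show ?thesis by blast
qed

end
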